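(* Suppose $H_0: F_1=F_2=\cdots=F_k$ holds. For $j=2,\ldots,k$ let $c_j=k(j-1)/j$ and $$T_{jn}(x)=\sqrt n\,\sqrt{c_j}\left[\hat F_j(x)-\frac{1}{j-1}\sum_{l=1}^{j-1}\hat F_l(x)\right],\quad x\ge 0,$$ and let $T_n=\max_{2\le j\le k}\ \sup_{x\ge 0}T_{jn}(x)$. Then, as $n\to\infty$, $T_n$ converges in distribution to a random variable $\mathcal T$ with $$P(\mathcal T\ge t)=1-[2\Phi(t)-1]^{k-1},\quad t\ge 0,$$ where $\Phi$ is the standard normal distribution function.
   Context: Competing risks model: $k\ge 3$ is fixed, $(T,\delta)$ is a random pair with $T\ge 0$ having a continuous distribution function $F$, and $\delta\in\{1,\ldots,k\}$. The cumulative incidence functions are $F_j(t)=P[T\le t,\ \delta=j]$, so $F=\sum_{j=1}^k F_j$. One observes i.i.d. copies $(T_i,\delta_i)$, $1\le i\le n$, of $(T,\delta)$, and $\hat F_j(t)=\frac1n\sum_{i=1}^n I(T_i\le t,\ \delta_i=j)$, $j=1,\ldots,k$. *)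

theory Defs
  imports "HOL-Probability.Probability"
begin

definition cum_inc :: "'a measure \<Rightarrow> ('a \<Rightarrow> real) \<Rightarrow> ('a \<Rightarrow> nat) \<Rightarrow> nat \<Rightarrow> real \<Rightarrow> real" where
  "cum_inc P T \<delta> j t = measure P {\<omega> \<in> space P. T \<omega> \<le> t \<and> \<delta> \<omega> = j}"

definition emp_cum_inc ::
  "(nat \<Rightarrow> 'a \<Rightarrow> real) \<Rightarrow> (nat \<Rightarrow> 'a \<Rightarrow> nat) \<Rightarrow> nat \<Rightarrow> nat \<Rightarrow> 'a \<Rightarrow> real \<Rightarrow> real" where
  "emp_cum_inc Ts \<delta>s n j \<omega> t =
     (1 / real n) * (\<Sum>i=1..n. if Ts i \<omega> \<le> t \<and> \<delta>s i \<omega> = j then 1 else 0)"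

definition contrast_const :: "nat \<Rightarrow> nat \<Rightarrow> real" where
  "contrast_const k j = real k * (real j - 1) / real j"

definition contrast_process ::
  "nat \<Rightarrow> (nat \<Rightarrow> 'a \<Rightarrow> real) \<Rightarrow> (nat \<Rightarrow> 'a \<Rightarrow> nat) \<Rightarrow> nat \<Rightarrow> nat \<Rightarrow> 'a \<Rightarrow> real \<Rightarrow> real" where
  "contrast_process k Ts \<delta>s n j \<omega> x =
     sqrt (real n) * sqrt (contrast_const k j) *
       (emp_cum_inc Ts \<delta>s n j \<omega> x
        - (1 / (real j - 1)) * (\<Sum>l=1..j-1. emp_cum_inc Ts \<delta>s n l \<omega> x))"

text \<open>The real-valued supremum below is a genuine one: for each fixed \<open>n\<close>, \<open>j\<close> and \<open>\<omega>\<close>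
  the path \<open>x \<mapsto> contrast_process k Ts \<delta>s n j \<omega> x\<close> takes only finitely many values.\<close>

definition max_sup_stat ::
  "nat \<Rightarrow> (nat \<Rightarrow> 'a \<Rightarrow> real) \<Rightarrow> (nat \<Rightarrow> 'a \<Rightarrow> nat) \<Rightarrow> nat \<Rightarrow> 'a \<Rightarrow> real" where
  "max_sup_stat k Ts \<delta>s n \<omega> =
     Max ((\<lambda>j. SUP x\<in>{0..}. contrast_process k Ts \<delta>s n j \<omega> x) ` {2..k})"

abbreviation std_normal_cdf :: "real \<Rightarrow> real" where
  "std_normal_cdf \<equiv> cdf std_normal_distribution"

end

theory Submission
  imports Defs "HOL-Real_Asymp.Real_Asymp"
begin

text \<open>Under \<open>H\<^sub>0\<close> the causes are uniform on \<open>{1..k}\<close> and independent of the times, so, read in the order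
  of the times, the contrast processes form a random walk in dimension \<open>k - 1\<close> whose steps are centred
  with identity covariance: the statistic is at most \<open>t\<close> iff the walk, scaled by \<open>1 / sqrt n\<close>,
  has all coordinates at most \<open>t\<close> throughout its \<open>n\<close> steps.

  The survival probability of this walk is compared with the solution
  \<open>\<Prod>j. 2 \<Phi>(y\<^sub>j / sqrt s) - 1\<close> of the heat equation in the orthant with zero boundary values, where
  \<open>y\<^sub>j\<close> is the distance of coordinate \<open>j\<close> to the barrier. A Taylor expansion shows that one step of the
  walk advances the solution by the time \<open>1 / n\<close> up to an error \<open>O(n powr (-3/2))\<close>, uniformly for
  \<open>s \<ge> \<epsilon>\<close>. Starting the solution at time \<open>\<epsilon>\<close> bounds the survival probability from below; moving
  the barrier away by a further \<open>\<eta>\<close> bounds it from above. Both bounds agree as \<open>\<epsilon> \<rightarrow> 0\<close> with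
  \<open>\<eta> \<rightarrow> 0\<close> and \<open>\<eta> / sqrt \<epsilon> \<rightarrow> \<infinity>\<close>.\<close>

section \<open>The distribution function of the absolute value of a normal variable\<close>

text \<open>The law of the modulus of a normal variable, continued as an odd function to negative
  arguments. The continuation matters: the Taylor expansions must also hold at points that a step
  has carried across the barrier.\<close>

definition abs_normal_cdf :: "real \<Rightarrow> real" where
  "abs_normal_cdf z = 2 * std_normal_cdf z - 1"

definition abs_normal_density :: "real \<Rightarrow> real" where
  "abs_normal_density z = 2 * std_normal_density z"

section \<open>Derivatives and symmetry of the normal distribution function\<close>

lemma continuous_on_std_normal_density: "continuous_on A std_normal_density"
  unfolding std_normal_density_def by (intro continuous_intros) auto

lemma std_normal_cdf_diff:
  assumes "a \<le> b"
  shows "std_normal_cdf b - std_normal_cdf a = integral {a..b} std_normal_density"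
proof -
  interpret real_distribution std_normal_distribution by (rule real_dist_normal_dist)
  define I where "I = integral {a..b} std_normal_density"
  have "(std_normal_density has_integral I) {a..b}"
    unfolding I_def
    by (intro integrable_integral integrable_continuous_interval continuous_on_std_normal_density)
  \<comment> \<open>The distribution function measures half-open intervals; the missing endpoint is
    a null set.\<close>
  then have *: "(std_normal_density has_integral I) {a<..b}"
    by (subst has_integral_spike_set_eq[where T = "{a..b}"])
      (auto intro: negligible_subset[of "{a}"])
  have I0: "0 \<le> I"
    unfolding I_def by (rule integral_nonneg)
      (auto intro!: integrable_continuous_interval continuous_on_std_normal_density)
  have "emeasure std_normal_distribution {a<..b} =
      (\<integral>\<^sup>+x. indicator {a<..b} x * ennreal (std_normal_density x) \<partial>lborel)"
    by (subst emeasure_density) (auto simp: mult.commute)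
  also have "\<dots> = ennreal I"
    using nn_integral_has_integral_lebesgue[OF _ *] by (simp add: ennreal_mult' ennreal_indicator)
  finally have "ennreal (cdf std_normal_distribution b - cdf std_normal_distribution a) = ennreal I"
    using emeasure_Ioc[OF assms] by simp
  then show ?thesis
    using I0 cdf_nondecreasing[OF assms] by (simp add: I_def)
qed

lemma DERIV_std_normal_cdf: "(std_normal_cdf has_real_derivative std_normal_density z) (at z)"
proof -
  have "((\<lambda>u. integral {z-1..u} std_normal_density) has_vector_derivative std_normal_density z)
      (at z within {z-1..z+1})"
    by (rule integral_has_vector_derivative[OF continuous_on_std_normal_density]) auto
  then have "((\<lambda>u. integral {z-1..u} std_normal_density) has_real_derivative std_normal_density z) (at z)"
    by (simp add: has_real_derivative_iff_has_vector_derivative at_within_Icc_at)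
  \<comment> \<open>On the unit neighbourhood of \<open>z\<close> the distribution function is the
    integral from \<open>z-1\<close> plus this constant, so it inherits the derivative given by the
    fundamental theorem of calculus.\<close>
  then have D: "((\<lambda>u. integral {z-1..u} std_normal_density + std_normal_cdf (z-1))
      has_real_derivative std_normal_density z) (at z)"
    by (auto intro!: derivative_eq_intros)
  show ?thesis
    by (rule has_field_derivative_transform_within[OF D, of 1])
      (auto simp: dist_real_def std_normal_cdf_diff[symmetric])
qed

lemma DERIV_abs_normal_cdf [derivative_intros]:
  "(abs_normal_cdf has_real_derivative abs_normal_density z) (at z)"
  unfolding abs_normal_cdf_def[abs_def] abs_normal_density_def
  by (auto intro!: derivative_eq_intros DERIV_std_normal_cdf)

lemma DERIV_abs_normal_density:
  "(abs_normal_density has_real_derivative - z * abs_normal_density z) (at z)"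
  unfolding abs_normal_density_def[abs_def] std_normal_density_def
  by (auto intro!: derivative_eq_intros simp: field_simps)

lemmas DERIV_abs_normal_cdf_chain [derivative_intros] = DERIV_chain2[OF DERIV_abs_normal_cdf]
lemmas DERIV_abs_normal_density_chain [derivative_intros] = DERIV_chain2[OF DERIV_abs_normal_density]

lemma isCont_abs_normal_cdf: "isCont abs_normal_cdf z"
  using DERIV_abs_normal_cdf by (rule DERIV_isCont)

lemma abs_normal_cdf_mono: "x \<le> y \<Longrightarrow> abs_normal_cdf x \<le> abs_normal_cdf y"
  using real_distribution.finite_borel_measure_M[OF real_dist_normal_dist]
  by (simp add: abs_normal_cdf_def finite_borel_measure.cdf_nondecreasing)

lemma abs_normal_cdf_at_top: "(abs_normal_cdf \<longlongrightarrow> 1) at_top"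
proof -
  have "((\<lambda>z. 2 * std_normal_cdf z - 1) \<longlongrightarrow> 2 * 1 - 1) at_top"
    by (intro tendsto_intros real_distribution.cdf_lim_at_top_prob real_dist_normal_dist)
  then show ?thesis by (simp add: abs_normal_cdf_def[abs_def])
qed

text \<open>The density is even, so \<open>std_normal_cdf z + std_normal_cdf (- z)\<close> has
  derivative zero; the limit at infinity identifies the constant as 1.\<close>

lemma abs_normal_cdf_minus: "abs_normal_cdf (- z) = - abs_normal_cdf z"
proof -
  have lim: "((\<lambda>z. std_normal_cdf z + std_normal_cdf (- z)) \<longlongrightarrow> 1 + 0) at_top"
    using real_distribution.finite_borel_measure_M[OF real_dist_normal_dist]
    by (intro tendsto_intros real_distribution.cdf_lim_at_top_prob real_dist_normal_dist
        filterlim_compose[OF finite_borel_measure.cdf_lim_at_bot filterlim_uminus_at_bot_at_top])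
  have "std_normal_density (- x) = std_normal_density x" for x :: real
    by (simp add: std_normal_density_def)
  then have "((\<lambda>z. std_normal_cdf z + std_normal_cdf (- z)) has_real_derivative 0) (at x)" for x
    by (auto intro!: derivative_eq_intros DERIV_chain2[OF DERIV_std_normal_cdf]
        DERIV_std_normal_cdf simp del: normal_density_def)
  then have "std_normal_cdf x + std_normal_cdf (- x) = std_normal_cdf z + std_normal_cdf (- z)" for x
    using DERIV_isconst_all[of "\<lambda>z. std_normal_cdf z + std_normal_cdf (- z)" x z] by blast
  then have "((\<lambda>z::real. std_normal_cdf z + std_normal_cdf (- z))
      = (\<lambda>_. std_normal_cdf z + std_normal_cdf (- z)))"
    by blast
  with lim have "std_normal_cdf z + std_normal_cdf (- z) = 1"
    by (simp add: tendsto_const_iff)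
  then show ?thesis by (simp add: abs_normal_cdf_def)
qed

lemma abs_normal_cdf_0 [simp]: "abs_normal_cdf 0 = 0"
  using abs_normal_cdf_minus[of 0] by simp

lemma abs_normal_cdf_nonneg: "0 \<le> z \<Longrightarrow> 0 \<le> abs_normal_cdf z"
  using abs_normal_cdf_mono[of 0 z] by simp

lemma abs_normal_cdf_abs_le_1: "\<bar>abs_normal_cdf z\<bar> \<le> 1"
  using real_distribution.finite_borel_measure_M[OF real_dist_normal_dist]
    real_distribution.cdf_bounded_prob[OF real_dist_normal_dist, of z]
    finite_borel_measure.cdf_nonneg[of _ z]
  by (auto simp: abs_normal_cdf_def abs_le_iff)

lemma abs_normal_cdf_pos:
  assumes "0 < z" shows "0 < abs_normal_cdf z"
  using DERIV_pos_imp_increasing[of 0 z abs_normal_cdf] assms DERIV_abs_normal_cdf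
  by (force simp: abs_normal_density_def normal_density_pos)

lemma abs_normal_density_nonneg: "0 \<le> abs_normal_density z"
  by (simp add: abs_normal_density_def)

text \<open>Since \<open>2 < sqrt (2 * pi)\<close>, the density is at most
  \<open>exp (- z\<^sup>2 / 2)\<close>. The terms \<open>z\<^sup>2 / 2\<close> and
  \<open>z ^ 4 / 8\<close> of the quadratic Taylor bound for \<open>exp (z\<^sup>2 / 2)\<close> then
  give the constants 2 and 8.\<close>

lemma abs_normal_density_moment_bounds:
  "abs_normal_density z \<le> 1" "z\<^sup>2 * abs_normal_density z \<le> 2" "z ^ 4 * abs_normal_density z \<le> 8"
proof -
  have "3 < pi" by (rule pi_gt3)
  then have "2 < sqrt (2 * pi)" by (intro real_less_rsqrt) auto
  then have le: "abs_normal_density z \<le> exp (- z\<^sup>2 / 2)"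
    by (simp add: abs_normal_density_def std_normal_density_def field_simps)
  have e: "1 + z\<^sup>2 / 2 + (z\<^sup>2 / 2)\<^sup>2 / 2 \<le> exp (z\<^sup>2 / 2)"
    by (rule exp_lower_Taylor_quadratic) simp
  have *: "c * abs_normal_density z \<le> d" if "0 \<le> c" "c \<le> d * exp (z\<^sup>2 / 2)" for c d
  proof -
    have "c * abs_normal_density z \<le> (d * exp (z\<^sup>2 / 2)) * exp (- z\<^sup>2 / 2)"
      using that le abs_normal_density_nonneg by (intro mult_mono) auto
    also have "\<dots> = d" by (simp add: mult.assoc flip: exp_add)
    finally show ?thesis .
  qed
  show "abs_normal_density z \<le> 1" using *[of 1 1] by simp
  have "0 \<le> (z\<^sup>2 / 2)\<^sup>2" "0 \<le> z\<^sup>2" "(z\<^sup>2 / 2)\<^sup>2 = z ^ 4 / 4"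
    by (auto simp: power_divide simp flip: power_mult)
  with e show "z\<^sup>2 * abs_normal_density z \<le> 2" "z ^ 4 * abs_normal_density z \<le> 8"
    by (intro *; linarith?)+
qed

text \<open>Interpolation by \<open>\<bar>z\<bar> \<le> 1/2 + z\<^sup>2 / 2\<close> reduces the odd
  powers to the even ones.\<close>

lemma abs_normal_density_odd_moment_bounds:
  "\<bar>z * abs_normal_density z\<bar> \<le> 2" "\<bar>z ^ 3 * abs_normal_density z\<bar> \<le> 5"
proof -
  have "2 * \<bar>z\<bar> \<le> 1 + z\<^sup>2" using zero_le_power2[of "1 - \<bar>z\<bar>"] by (simp add: power2_diff)
  then have "\<bar>z\<bar> \<le> 1/2 + z\<^sup>2 / 2" by simp
  from mult_right_mono[OF this abs_normal_density_nonneg[of z]]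
  show "\<bar>z * abs_normal_density z\<bar> \<le> 2"
    using abs_normal_density_moment_bounds[of z] abs_normal_density_nonneg[of z]
    by (simp add: abs_mult algebra_simps)
  have "\<bar>z\<bar> ^ 3 = \<bar>z\<bar> * z\<^sup>2" by (simp add: power3_eq_cube power2_eq_square)
  also have "\<dots> \<le> (1/2 + z\<^sup>2 / 2) * z\<^sup>2"
    using \<open>\<bar>z\<bar> \<le> 1/2 + z\<^sup>2 / 2\<close> by (intro mult_right_mono) auto
  finally have "\<bar>z\<bar> ^ 3 \<le> z\<^sup>2 / 2 + z ^ 4 / 2" by (simp add: algebra_simps power2_eq_square power4_eq_xxxx)
  from mult_right_mono[OF this abs_normal_density_nonneg[of z]]
  show "\<bar>z ^ 3 * abs_normal_density z\<bar> \<le> 5"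
    using abs_normal_density_moment_bounds[of z] abs_normal_density_nonneg[of z]
    by (simp add: abs_mult algebra_simps power_abs)
qed

text \<open>The third derivative, \<open>z\<^sup>2 - 1\<close> times the density, is bounded, which
  makes the remainder uniform in \<open>z\<close>.\<close>

lemma abs_normal_cdf_Taylor:
  "\<bar>abs_normal_cdf (z + w) - (abs_normal_cdf z + w * abs_normal_density z
      - w\<^sup>2 / 2 * (z * abs_normal_density z))\<bar> \<le> \<bar>w\<bar> ^ 3"
proof -
  let ?D = abs_normal_density
  define diff where "diff m x = (if m = 0 then abs_normal_cdf (z + x) else if m = 1 then ?D (z + x)
    else if m = 2 then - (z + x) * ?D (z + x) else ((z + x)\<^sup>2 - 1) * ?D (z + x))"
    for m :: nat and x
  have "\<exists>t. \<bar>t\<bar> \<le> \<bar>w\<bar> \<and> diff 0 w = (\<Sum>m<3. diff m 0 / fact m * w ^ m) + diff 3 t / fact 3 * w ^ 3"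
  proof (rule Maclaurin_bi_le[OF refl], intro allI impI, elim conjE)
    fix m :: nat and t assume "m < 3"
    then consider "m = 0" | "m = 1" | "m = 2" by linarith
    then show "(diff m has_real_derivative diff (Suc m) t) (at t)"
      by cases (auto simp: diff_def[abs_def] power2_eq_square algebra_simps
          intro!: derivative_eq_intros)
  qed
  then obtain t where t: "diff 0 w = (\<Sum>m<3. diff m 0 / fact m * w ^ m) + diff 3 t / fact 3 * w ^ 3"
    by blast
  have "diff 3 t = (z + t)\<^sup>2 * ?D (z + t) - ?D (z + t)"
    by (simp add: diff_def left_diff_distrib)
  moreover have "0 \<le> (z + t)\<^sup>2 * ?D (z + t)"
    by (simp add: abs_normal_density_nonneg)
  ultimately have "\<bar>diff 3 t\<bar> \<le> 3"
    using abs_normal_density_moment_bounds[of "z+t"] abs_normal_density_nonneg[of "z+t"]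
    by linarith
  then have "\<bar>diff 3 t / fact 3 * w ^ 3\<bar> \<le> 3 / 6 * \<bar>w\<bar> ^ 3"
    using mult_right_mono[of "\<bar>diff 3 t\<bar>" 3 "\<bar>w\<bar> ^ 3"]
    by (simp add: abs_mult power_abs fact_numeral)
  also have "\<dots> \<le> \<bar>w\<bar> ^ 3" by simp
  finally show ?thesis
    using t by (simp add: diff_def numeral_3_eq_3 power2_eq_square fact_numeral algebra_simps)
qed

lemma abs_normal_cdf_Lipschitz: "\<bar>abs_normal_cdf x - abs_normal_cdf y\<bar> \<le> \<bar>x - y\<bar>"
proof -
  have "norm (abs_normal_cdf x - abs_normal_cdf y) \<le> 1 * norm (x - y)"
    by (rule field_differentiable_bound[where S = UNIV and f' = abs_normal_density])
      (auto simp: abs_normal_density_moment_bounds abs_normal_density_nonneg intro: DERIV_abs_normal_cdf)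
  then show ?thesis by simp
qed

text \<open>For positive \<open>s\<close> and nonnegative \<open>y\<close> this is, by the
  reflection principle, the probability that a Brownian motion started at \<open>y\<close> stays
  positive up to time \<open>s\<close>.\<close>

definition heat :: "real \<Rightarrow> real \<Rightarrow> real" where
  "heat s y = abs_normal_cdf (y / sqrt s)"

definition heat_x :: "real \<Rightarrow> real \<Rightarrow> real" where
  "heat_x s y = abs_normal_density (y / sqrt s) / sqrt s"

definition heat_xx :: "real \<Rightarrow> real \<Rightarrow> real" where
  "heat_xx s y = - (y / sqrt s) * abs_normal_density (y / sqrt s) / s"

text \<open>The first-order term is the heat equation: the derivative in \<open>s\<close> is
  \<open>heat_xx s y / 2\<close>.\<close>

lemma heat_time_Taylor:
  assumes "0 < s" "0 \<le> r"
  shows "\<bar>heat (s + r) y - (heat s y + r / 2 * heat_xx s y)\<bar> \<le> 3 * r\<^sup>2 / s\<^sup>2"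
proof (cases "r = 0")
  case False
  let ?D = abs_normal_density
  \<comment> \<open>The second derivative in time, which is a quarter of the fourth derivative in
    \<open>y\<close>; the odd moment bounds control it by \<open>6 / u\<^sup>2\<close>.\<close>
  define h2 where "h2 u = (3/4 * (y / sqrt u) * ?D (y / sqrt u)
      - 1/4 * (y / sqrt u) ^ 3 * ?D (y / sqrt u)) / u\<^sup>2" for u
  define diff where "diff m u = (if m = 0 then heat u y else if m = 1 then heat_xx u y / 2 else h2 u)"
    for m :: nat and u
  have "\<exists>t>s. t < s + r \<and> heat (s + r) y =
      (\<Sum>m<2. (diff m s / fact m) * (s + r - s)^m) + (diff 2 t / fact 2) * (s + r - s)^2"
  proof (rule Taylor_up[where a = s])
    show "\<forall>m t. m < 2 \<and> s \<le> t \<and> t \<le> s + r \<longrightarrow> (diff m has_real_derivative diff (Suc m) t) (at t)"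
    proof (intro allI impI, elim conjE)
      fix m :: nat and t assume "m < 2" "s \<le> t"
      have t: "0 < t" using \<open>s \<le> t\<close> \<open>0 < s\<close> by simp
      \<comment> \<open>Writing \<open>t\<close> as \<open>q * q\<close> clears the square roots
        from the derivative identities.\<close>
      define q where "q = sqrt t"
      have q: "0 < q" "t = q * q" "sqrt t = q" using t by (auto simp: q_def)
      consider "m = 0" | "m = 1" using \<open>m < 2\<close> by linarith
      then show "(diff m has_real_derivative diff (Suc m) t) (at t)"
      proof cases
        case 1
        show ?thesis unfolding 1 using t
          apply (simp add: diff_def[abs_def] heat_def[abs_def] heat_xx_def)
          apply (rule derivative_eq_intros refl | simp)+
          using q by (simp add: field_simps)
      next
        case 2
        show ?thesis unfolding 2 using t
          apply (simp add: diff_def[abs_def] heat_xx_def[abs_def] h2_def)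
          apply (rule derivative_eq_intros refl | simp)+
          using q by (simp add: field_simps power3_eq_cube power2_eq_square)
      qed
    qed
  qed (use assms False in \<open>auto simp: diff_def[abs_def]\<close>)
  then obtain t where t: "s < t" "heat (s + r) y = heat s y + r / 2 * heat_xx s y + h2 t / 2 * r\<^sup>2"
    by (auto simp: diff_def numeral_2_eq_2)
  have "\<bar>3/4 * (z * ?D z) - 1/4 * (z ^ 3 * ?D z)\<bar> \<le> 6" for z
    using abs_normal_density_odd_moment_bounds[of z] by linarith
  from this[of "y / sqrt t"] have "\<bar>h2 t\<bar> \<le> 6 / t\<^sup>2"
    unfolding h2_def abs_divide by (intro divide_mono) (use assms t in \<open>auto simp: mult.assoc\<close>)
  also have "\<dots> \<le> 6 / s\<^sup>2" using assms t by (intro divide_left_mono power_mono mult_pos_pos) auto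
  finally have "\<bar>h2 t / 2 * r\<^sup>2\<bar> \<le> 6 / s\<^sup>2 / 2 * r\<^sup>2"
    unfolding abs_mult by (intro mult_mono) auto
  then show ?thesis using t(2) by simp
qed simp

lemma heat_space_Taylor:
  assumes "0 < s"
  shows "\<bar>heat s (y - r) - (heat s y - r * heat_x s y + r\<^sup>2 / 2 * heat_xx s y)\<bar> \<le> (\<bar>r\<bar> / sqrt s) ^ 3"
proof -
  have "y / sqrt s + - r / sqrt s = (y - r) / sqrt s" by (simp add: diff_divide_distrib)
  then show ?thesis
    using abs_normal_cdf_Taylor[of "y / sqrt s" "- r / sqrt s"] assms
    by (simp add: heat_def heat_x_def heat_xx_def power_divide ac_simps)
qed

section \<open>One step of the walk\<close>

lemma heat_abs_le_1: "\<bar>heat s y\<bar> \<le> 1"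
  by (simp add: heat_def abs_normal_cdf_abs_le_1)

lemma heat_nonneg: "0 \<le> s \<Longrightarrow> 0 \<le> y \<Longrightarrow> 0 \<le> heat s y"
  by (simp add: heat_def abs_normal_cdf_nonneg)

lemma heat_mono: "0 \<le> s \<Longrightarrow> x \<le> y \<Longrightarrow> heat s x \<le> heat s y"
  by (simp add: heat_def abs_normal_cdf_mono divide_right_mono)

text \<open>The solution vanishes at the barrier, so the Lipschitz bound makes it small wherever a
  step overshoots only slightly.\<close>

lemma heat_abs_le:
  assumes "0 < \<epsilon>" "\<epsilon> \<le> s"
  shows "\<bar>heat s y\<bar> \<le> \<bar>y\<bar> / sqrt \<epsilon>"
proof -
  have "\<bar>heat s y\<bar> \<le> \<bar>y\<bar> / sqrt s"
    using abs_normal_cdf_Lipschitz[of "y / sqrt s" 0] assms by (simp add: heat_def)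
  also have "\<dots> \<le> \<bar>y\<bar> / sqrt \<epsilon>"
    using assms by (intro divide_left_mono) auto
  finally show ?thesis .
qed

section \<open>Products of second-order expansions\<close>

lemma expansion_mult:
  fixes a M :: real
  assumes a: "0 \<le> a" "a \<le> 1"
    and u: "\<bar>u0\<bar> \<le> M" "\<bar>u1\<bar> \<le> M" "\<bar>u2\<bar> \<le> M" and v: "\<bar>v0\<bar> \<le> M" "\<bar>v1\<bar> \<le> M" "\<bar>v2\<bar> \<le> M"
    and U: "\<bar>U - (u0 + a * u1 + a\<^sup>2 * u2)\<bar> \<le> M * a ^ 3"
    and V: "\<bar>V - (v0 + a * v1 + a\<^sup>2 * v2)\<bar> \<le> M * a ^ 3"
  shows "\<bar>U * V - (u0 * v0 + a * (u0 * v1 + u1 * v0) + a\<^sup>2 * (u0 * v2 + u1 * v1 + u2 * v0))\<bar>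
    \<le> 10 * M\<^sup>2 * a ^ 3"
proof -
  define u where "u = u0 + a * u1 + a\<^sup>2 * u2"
  define v where "v = v0 + a * v1 + a\<^sup>2 * v2"
  have M: "0 \<le> M" using u by linarith
  have a2: "a\<^sup>2 \<le> 1" "a ^ 3 \<le> 1" "0 \<le> a ^ 3" using a by (auto simp: power_le_one)
  have *: "\<bar>c * x\<bar> \<le> M" if "0 \<le> c" "c \<le> 1" "\<bar>x\<bar> \<le> M" for c x :: real
    using mult_mono[OF that(2,3)] that M by (simp add: abs_mult)
  have bu: "\<bar>u\<bar> \<le> 3 * M"
    using u *[of a u1] *[of "a\<^sup>2" u2] a a2 unfolding u_def by fastforce
  have bv: "\<bar>v\<bar> \<le> 3 * M"
    using v *[of a v1] *[of "a\<^sup>2" v2] a a2 unfolding v_def by fastforce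
  have "\<bar>V - v\<bar> \<le> M"
    using V M a2 mult_left_mono[OF a2(2) M] by (simp add: v_def)
  then have bV: "\<bar>V\<bar> \<le> 4 * M" using bv by linarith
  \<comment> \<open>The constant 10 is 4 + 3 + 3: the error of \<open>U\<close> times
    \<open>V\<close>, the error of \<open>V\<close> times \<open>u\<close>, and the terms of
    \<open>u * v\<close> of order at least \<open>a ^ 3\<close>.\<close>
  have 1: "\<bar>(U - u) * V\<bar> \<le> (M * a ^ 3) * (4 * M)"
    unfolding abs_mult using U bV M a2 by (intro mult_mono) (auto simp: u_def)
  have 2: "\<bar>u * (V - v)\<bar> \<le> (3 * M) * (M * a ^ 3)"
    unfolding abs_mult using V bu M a2 by (intro mult_mono) (auto simp: v_def)
  have MM: "\<bar>x * y\<bar> \<le> M * M" if "\<bar>x\<bar> \<le> M" "\<bar>y\<bar> \<le> M" for x y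
    unfolding abs_mult using that M by (intro mult_mono) auto
  have "\<bar>a * (u2 * v2)\<bar> \<le> 1 * (M * M)"
    unfolding abs_mult[of a] using a MM u v by (intro mult_mono) auto
  then have "\<bar>u1 * v2 + u2 * v1 + a * (u2 * v2)\<bar> \<le> 3 * (M * M)"
    using MM[OF u(2) v(3)] MM[OF u(3) v(2)] by linarith
  then have 3: "\<bar>a ^ 3 * (u1 * v2 + u2 * v1 + a * (u2 * v2))\<bar> \<le> a ^ 3 * (3 * (M * M))"
    unfolding abs_mult[of "a ^ 3"] using a2 by (intro mult_mono) auto
  have "U * V - (u0 * v0 + a * (u0 * v1 + u1 * v0) + a\<^sup>2 * (u0 * v2 + u1 * v1 + u2 * v0))
     = (U - u) * V + u * (V - v) + a ^ 3 * (u1 * v2 + u2 * v1 + a * (u2 * v2))"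
    by (simp add: u_def v_def algebra_simps power2_eq_square power3_eq_cube)
  then show ?thesis using 1 2 3 by (simp add: power2_eq_square algebra_simps)
qed

section \<open>Walks whose steps, for uniform \<open>d\<close>, are centred with identity
  covariance\<close>

locale orthonormal_steps =
  fixes D :: "'d set" and J :: "'j set" and \<xi> :: "'j \<Rightarrow> 'd \<Rightarrow> real"
  assumes finite_D: "finite D" and D_nonempty: "D \<noteq> {}" and finite_J: "finite J"
    and centered: "j \<in> J \<Longrightarrow> (\<Sum>d\<in>D. \<xi> j d) = 0"
    and orthonormal: "i \<in> J \<Longrightarrow> j \<in> J \<Longrightarrow>
      (\<Sum>d\<in>D. \<xi> i d * \<xi> j d) = (if i = j then real (card D) else 0)"
begin

lemma card_D_pos: "0 < card D"
  using finite_D D_nonempty by (simp add: card_gt_0_iff)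

lemma steps_bounded: obtains X where "1 \<le> X" "\<And>j d. j \<in> J \<Longrightarrow> d \<in> D \<Longrightarrow> \<bar>\<xi> j d\<bar> \<le> X"
proof
  let ?X = "1 + (\<Sum>j\<in>J. \<Sum>d\<in>D. \<bar>\<xi> j d\<bar>)"
  show "1 \<le> ?X" by (simp add: sum_nonneg)
  fix j d assume "j \<in> J" "d \<in> D"
  have "\<bar>\<xi> j d\<bar> \<le> (\<Sum>d\<in>D. \<bar>\<xi> j d\<bar>)"
    using \<open>d \<in> D\<close> finite_D by (intro member_le_sum) auto
  also have "\<dots> \<le> (\<Sum>j\<in>J. \<Sum>d\<in>D. \<bar>\<xi> j d\<bar>)"
    using \<open>j \<in> J\<close> finite_J by (intro member_le_sum) (auto simp: sum_nonneg)
  finally show "\<bar>\<xi> j d\<bar> \<le> ?X" by simp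
qed

text \<open>\<open>A j d\<close> stands for factor \<open>j\<close> after the step \<open>d\<close>
  of scale \<open>a\<close>, and \<open>B j\<close> for the same factor after the time
  \<open>a\<^sup>2\<close>; \<open>\<alpha>\<close>, \<open>p\<close>, \<open>q\<close> are its
  value, slope and second derivative. The heat equation enters through the common
  \<open>q j / 2\<close>.\<close>

definition factor_expansion ::
  "'j set \<Rightarrow> real \<Rightarrow> real \<Rightarrow> ('j \<Rightarrow> real) \<Rightarrow> ('j \<Rightarrow> real) \<Rightarrow> ('j \<Rightarrow> real) \<Rightarrow> ('j \<Rightarrow> 'd \<Rightarrow> real)
    \<Rightarrow> ('j \<Rightarrow> real) \<Rightarrow> bool" where
  "factor_expansion I K a \<alpha> p q A B \<longleftrightarrow>
    (\<forall>j\<in>I. \<bar>\<alpha> j\<bar> \<le> K \<and> \<bar>p j\<bar> \<le> K \<and> \<bar>q j\<bar> \<le> K \<and>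
      \<bar>B j - (\<alpha> j + a\<^sup>2 * (q j / 2))\<bar> \<le> K * a ^ 3 \<and>
      (\<forall>d\<in>D. \<bar>A j d - (\<alpha> j + a * (\<xi> j d * p j) + a\<^sup>2 * ((\<xi> j d)\<^sup>2 * (q j / 2)))\<bar> \<le> K * a ^ 3))"

text \<open>The same \<open>c\<close> is the second-order coefficient of \<open>\<Prod>j\<in>I. B j\<close> and of the average over \<open>d\<close> of
  \<open>\<Prod>j\<in>I. A j d\<close>: orthogonality of the steps makes the mixed second-order terms average to zero.\<close>

definition product_expansion ::
  "'j set \<Rightarrow> real \<Rightarrow> real \<Rightarrow> ('j \<Rightarrow> real) \<Rightarrow> ('j \<Rightarrow> 'd \<Rightarrow> real) \<Rightarrow> ('j \<Rightarrow> real)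
    \<Rightarrow> ('j \<Rightarrow> real) \<Rightarrow> ('d \<Rightarrow> real) \<Rightarrow> real \<Rightarrow> bool" where
  "product_expansion I C a \<alpha> A B w b c \<longleftrightarrow>
    (\<forall>d\<in>D. \<bar>(\<Prod>j\<in>I. A j d) - ((\<Prod>j\<in>I. \<alpha> j) + a * (\<Sum>j\<in>I. \<xi> j d * w j) + a\<^sup>2 * b d)\<bar> \<le> C * a ^ 3) \<and>
    (\<forall>j\<in>I. \<bar>w j\<bar> \<le> C) \<and> (\<forall>d\<in>D. \<bar>b d\<bar> \<le> C) \<and> (\<Sum>d\<in>D. b d) = real (card D) * c \<and> \<bar>c\<bar> \<le> C \<and>
    \<bar>(\<Prod>j\<in>I. B j) - ((\<Prod>j\<in>I. \<alpha> j) + a\<^sup>2 * c)\<bar> \<le> C * a ^ 3 \<and> \<bar>\<Prod>j\<in>I. \<alpha> j\<bar> \<le> C"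

text \<open>Induction over the coordinates, multiplying in one factor at a time. \<open>C\<close> is
  chosen before \<open>a\<close> and the factors, so the bound is uniform. The linear coefficient is
  kept as a combination of the steps, so that orthogonality applies to its product with the next
  factor.\<close>

lemma prod_expansion:
  assumes "I \<subseteq> J" and K: "0 \<le> K"
  shows "\<exists>C\<ge>0. \<forall>a \<alpha> p q A B. 0 \<le> a \<longrightarrow> a \<le> 1 \<longrightarrow> factor_expansion I K a \<alpha> p q A B \<longrightarrow>
    (\<exists>w b c. product_expansion I C a \<alpha> A B w b c)"
proof -
  obtain X where X: "1 \<le> X" "\<And>j d. j \<in> J \<Longrightarrow> d \<in> D \<Longrightarrow> \<bar>\<xi> j d\<bar> \<le> X"
    using steps_bounded by blast
  have "finite I" using assms finite_J finite_subset by blast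
  then show ?thesis using \<open>I \<subseteq> J\<close>
  proof induction
    case empty
    \<comment> \<open>The empty product is 1, which forces a bound of at least 1.\<close>
    have "product_expansion {} 1 a \<alpha> A B (\<lambda>_. 0) (\<lambda>_. 0) 0" if "0 \<le> a" for a \<alpha> A B
      using that by (simp add: product_expansion_def)
    then show ?case using zero_le_one by blast
  next
    case (insert l I)
    then obtain C where C: "0 \<le> C" and IH: "\<And>a \<alpha> p q A B. 0 \<le> a \<Longrightarrow> a \<le> 1 \<Longrightarrow>
        factor_expansion I K a \<alpha> p q A B \<Longrightarrow> \<exists>w b c. product_expansion I C a \<alpha> A B w b c"
      by blast
    \<comment> \<open>\<open>M\<close> dominates every coefficient: \<open>X * K\<close> and
      \<open>X\<^sup>2 * K\<close> serve the first and second order terms of the new factor, the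
      last summand serves the linear sum \<open>S d\<close>.\<close>
    define M where "M = 1 + K + X * K + X\<^sup>2 * K + C + real (card I) * (X * C)"
    have nn: "0 \<le> X * K" "0 \<le> X\<^sup>2 * K" "0 \<le> real (card I) * (X * C)"
      using X K C by auto
    have M: "1 \<le> M" "K \<le> M" "X * K \<le> M" "X\<^sup>2 * K \<le> M" "C \<le> M" "real (card I) * (X * C) \<le> M"
      using nn K C by (auto simp: M_def)
    have MM: "\<bar>x * y\<bar> \<le> M\<^sup>2" if "\<bar>x\<bar> \<le> M" "\<bar>y\<bar> \<le> M" for x y
      unfolding abs_mult power2_eq_square using that M by (intro mult_mono) auto
    have M2: "0 \<le> M\<^sup>2" by simp
    show ?case
    proof (intro exI[of _ "10 * M\<^sup>2"] conjI allI impI)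
      show "0 \<le> 10 * M\<^sup>2" by simp
      fix a :: real and \<alpha> p q A B
      assume a: "0 \<le> a" "a \<le> 1" and H': "factor_expansion (insert l I) K a \<alpha> p q A B"
      then have "factor_expansion I K a \<alpha> p q A B" by (simp add: factor_expansion_def)
      from IH[OF a this] obtain w b c where "product_expansion I C a \<alpha> A B w b c" by blast
      then have E: "\<And>d. d \<in> D \<Longrightarrow> \<bar>(\<Prod>j\<in>I. A j d)
            - ((\<Prod>j\<in>I. \<alpha> j) + a * (\<Sum>j\<in>I. \<xi> j d * w j) + a\<^sup>2 * b d)\<bar> \<le> C * a ^ 3"
          "\<And>j. j \<in> I \<Longrightarrow> \<bar>w j\<bar> \<le> C" "\<And>d. d \<in> D \<Longrightarrow> \<bar>b d\<bar> \<le> C"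
          "(\<Sum>d\<in>D. b d) = real (card D) * c" "\<bar>c\<bar> \<le> C"
          "\<bar>(\<Prod>j\<in>I. B j) - ((\<Prod>j\<in>I. \<alpha> j) + a\<^sup>2 * c)\<bar> \<le> C * a ^ 3" "\<bar>\<Prod>j\<in>I. \<alpha> j\<bar> \<le> C"
        unfolding product_expansion_def by blast+
      from H' have H: "\<bar>\<alpha> l\<bar> \<le> K" "\<bar>p l\<bar> \<le> K" "\<bar>q l\<bar> \<le> K"
          "\<bar>B l - (\<alpha> l + a\<^sup>2 * (q l / 2))\<bar> \<le> K * a ^ 3"
          "\<And>d. d \<in> D \<Longrightarrow>
            \<bar>A l d - (\<alpha> l + a * (\<xi> l d * p l) + a\<^sup>2 * ((\<xi> l d)\<^sup>2 * (q l / 2)))\<bar> \<le> K * a ^ 3"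
        unfolding factor_expansion_def by blast+
      define \<pi> where "\<pi> = (\<Prod>j\<in>I. \<alpha> j)"
      define S where "S d = (\<Sum>j\<in>I. \<xi> j d * w j)" for d
      \<comment> \<open>Coefficients of the product with the new factor. \<open>b'\<close> contains
        the mixed term of the two linear parts, \<open>c'\<close> does not; that term has to average
        to zero.\<close>
      define w' where "w' j = (if j = l then p l * \<pi> else \<alpha> l * w j)" for j
      define b' where "b' d = \<alpha> l * b d + (\<xi> l d * p l) * S d + ((\<xi> l d)\<^sup>2 * (q l / 2)) * \<pi>" for d
      define c' where "c' = \<alpha> l * c + q l / 2 * \<pi>"
      have a3: "0 \<le> a ^ 3" using a by simp
      have KM: "K * a ^ 3 \<le> M * a ^ 3" and CM: "C * a ^ 3 \<le> M * a ^ 3"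
        using M a3 by (auto intro: mult_right_mono)
      have l: "\<bar>\<alpha> l\<bar> \<le> M" "\<bar>p l\<bar> \<le> M" "\<bar>q l / 2\<bar> \<le> M"
        using H(1-3) M(2) K by linarith+
      have pc: "\<bar>\<pi>\<bar> \<le> M" "\<bar>c\<bar> \<le> M" using E(5,7) M(5) unfolding \<pi>_def by linarith+
      have w: "\<bar>w j\<bar> \<le> M" if "j \<in> I" for j
        using E(2)[OF that] M(5) by linarith
      have d: "\<bar>\<xi> l d * p l\<bar> \<le> M" "\<bar>(\<xi> l d)\<^sup>2 * (q l / 2)\<bar> \<le> M" "\<bar>S d\<bar> \<le> M" "\<bar>b d\<bar> \<le> M" if "d \<in> D" for d
      proof -
        have xl: "\<bar>\<xi> l d\<bar> \<le> X" using X that insert by auto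
        have "\<bar>\<xi> l d * p l\<bar> \<le> X * K"
          unfolding abs_mult using xl H(2) X(1) by (intro mult_mono) auto
        then show "\<bar>\<xi> l d * p l\<bar> \<le> M" using M by linarith
        have "\<bar>q l / 2\<bar> \<le> K" using H(3) K by linarith
        then have "\<bar>(\<xi> l d)\<^sup>2 * (q l / 2)\<bar> \<le> X\<^sup>2 * K"
          unfolding abs_mult using power_mono[OF xl, of 2] X(1) by (intro mult_mono) auto
        then show "\<bar>(\<xi> l d)\<^sup>2 * (q l / 2)\<bar> \<le> M" using M by linarith
        have "\<bar>S d\<bar> \<le> (\<Sum>j\<in>I. \<bar>\<xi> j d * w j\<bar>)" unfolding S_def by (rule sum_abs)
        also have "\<dots> \<le> (\<Sum>j\<in>I. X * C)"
          unfolding abs_mult using X E(2) insert.prems that C by (intro sum_mono mult_mono) auto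
        finally show "\<bar>S d\<bar> \<le> M" using M by simp
        show "\<bar>b d\<bar> \<le> M" using E(3)[OF that] M(5) by linarith
      qed
      have "product_expansion (insert l I) (10 * M\<^sup>2) a \<alpha> A B w' b' c'"
        unfolding product_expansion_def
      proof (intro conjI ballI)
        fix e assume e: "e \<in> D"
        have *: "(\<Sum>j\<in>I. \<xi> j e * w' j) = \<alpha> l * S e"
          unfolding S_def sum_distrib_left
          by (rule sum.cong) (use insert.hyps in \<open>auto simp: w'_def\<close>)
        have "\<bar>A l e * (\<Prod>j\<in>I. A j e) - (\<alpha> l * \<pi> + a * (\<alpha> l * S e + (\<xi> l e * p l) * \<pi>)
            + a\<^sup>2 * (\<alpha> l * b e + (\<xi> l e * p l) * S e + ((\<xi> l e)\<^sup>2 * (q l / 2)) * \<pi>))\<bar> \<le> 10 * M\<^sup>2 * a ^ 3"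
          using a l pc d[OF e] order_trans[OF H(5)[OF e] KM] order_trans[OF E(1)[OF e] CM]
          unfolding \<pi>_def S_def by (intro expansion_mult)
        then show "\<bar>(\<Prod>j\<in>insert l I. A j e) - ((\<Prod>j\<in>insert l I. \<alpha> j)
            + a * (\<Sum>j\<in>insert l I. \<xi> j e * w' j) + a\<^sup>2 * b' e)\<bar> \<le> 10 * M\<^sup>2 * a ^ 3"
          using insert.hyps * by (simp add: \<pi>_def b'_def w'_def algebra_simps)
        show "\<bar>b' e\<bar> \<le> 10 * M\<^sup>2"
          using MM[OF l(1) d(4)[OF e]] MM[OF d(1)[OF e] d(3)[OF e]] MM[OF d(2)[OF e] pc(1)] M2
          unfolding b'_def by linarith
      next
        fix j assume "j \<in> insert l I"
        then have "\<bar>w' j\<bar> \<le> M\<^sup>2"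
          using MM[OF l(2) pc(1)] MM[OF l(1) w] by (auto simp: w'_def)
        then show "\<bar>w' j\<bar> \<le> 10 * M\<^sup>2" using M2 by linarith
      next
        \<comment> \<open>As \<open>l\<close> is not in \<open>I\<close>, the mixed term consists of
          off-diagonal covariances.\<close>
        have "(\<Sum>d\<in>D. (\<xi> l d * p l) * S d) = (\<Sum>d\<in>D. \<Sum>j\<in>I. p l * w j * (\<xi> l d * \<xi> j d))"
          unfolding S_def sum_distrib_left by (intro sum.cong refl) simp
        also have "\<dots> = (\<Sum>j\<in>I. p l * w j * (\<Sum>d\<in>D. \<xi> l d * \<xi> j d))"
          by (subst sum.swap) (simp add: sum_distrib_left)
        also have "\<dots> = 0"
        proof (intro sum.neutral ballI)
          fix j assume "j \<in> I"
          then have "j \<in> J" "l \<in> J" "l \<noteq> j" using insert by auto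
          then show "p l * w j * (\<Sum>d\<in>D. \<xi> l d * \<xi> j d) = 0" by (simp add: orthonormal)
        qed
        finally have 1: "(\<Sum>d\<in>D. (\<xi> l d * p l) * S d) = 0" .
        \<comment> \<open>Unit variance makes the averaged second-order term equal to the time
          coefficient \<open>q l / 2\<close>, up to the factor \<open>\<pi>\<close>.\<close>
        have 2: "(\<Sum>d\<in>D. ((\<xi> l d)\<^sup>2 * (q l / 2)) * \<pi>) = real (card D) * (q l / 2 * \<pi>)"
          using orthonormal[of l l] insert.prems
          by (simp add: power2_eq_square flip: sum_distrib_right sum_divide_distrib)
        have 3: "(\<Sum>d\<in>D. \<alpha> l * b d) = \<alpha> l * (real (card D) * c)"
          using E(4) by (simp flip: sum_distrib_left)
        show "(\<Sum>d\<in>D. b' d) = real (card D) * c'"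
          unfolding b'_def sum.distrib 1 2 3 by (simp add: c'_def algebra_simps)
      next
        show "\<bar>c'\<bar> \<le> 10 * M\<^sup>2"
          using MM[OF l(1) pc(2)] MM[OF l(3) pc(1)] M2 unfolding c'_def by linarith
      next
        \<comment> \<open>Expansions in time have no linear part, hence the zeros in place of the
          linear coefficients.\<close>
        have "\<bar>B l * (\<Prod>j\<in>I. B j) - (\<alpha> l * \<pi> + a * (\<alpha> l * 0 + 0 * \<pi>)
            + a\<^sup>2 * (\<alpha> l * c + 0 * 0 + q l / 2 * \<pi>))\<bar> \<le> 10 * M\<^sup>2 * a ^ 3"
          using a l pc order_trans[OF H(4) KM] order_trans[OF E(6) CM] M(1)
          unfolding \<pi>_def by (intro expansion_mult) auto
        then show "\<bar>(\<Prod>j\<in>insert l I. B j) - ((\<Prod>j\<in>insert l I. \<alpha> j) + a\<^sup>2 * c')\<bar> \<le> 10 * M\<^sup>2 * a ^ 3"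
          using insert.hyps by (simp add: \<pi>_def c'_def)
      next
        show "\<bar>\<Prod>j\<in>insert l I. \<alpha> j\<bar> \<le> 10 * M\<^sup>2"
          using insert.hyps MM[OF l(1) pc(1)] M2 by (simp add: \<pi>_def)
      qed
      then show "\<exists>w b c. product_expansion (insert l I) (10 * M\<^sup>2) a \<alpha> A B w b c" by blast
    qed
  qed
qed

text \<open>Both sides have the same expansion to second order: centring removes the linear term of
  the average, and \<open>prod_expansion\<close> supplies the common coefficient \<open>c\<close>.
  \<open>C\<close> does not depend on \<open>a\<close>, \<open>s\<close> or \<open>y\<close>, so the
  errors of successive steps can be added.\<close>

lemma heat_step:
  assumes \<epsilon>: "0 < \<epsilon>"
  shows "\<exists>C\<ge>0. \<forall>a s y. 0 \<le> a \<longrightarrow> a \<le> 1 \<longrightarrow> \<epsilon> \<le> s \<longrightarrow>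
    \<bar>(\<Sum>d\<in>D. \<Prod>j\<in>J. heat s (y j - a * \<xi> j d)) / real (card D) - (\<Prod>j\<in>J. heat (s + a\<^sup>2) (y j))\<bar>
      \<le> C * a ^ 3"
proof -
  obtain X where X: "1 \<le> X" "\<And>j d. j \<in> J \<Longrightarrow> d \<in> D \<Longrightarrow> \<bar>\<xi> j d\<bar> \<le> X"
    using steps_bounded by blast
  \<comment> \<open>One summand for each bound: value, slope, second derivative, time remainder and
    space remainder, all at times not below \<epsilon>.\<close>
  define K where "K = 1 + 1 / sqrt \<epsilon> + 2 / \<epsilon> + 3 / \<epsilon>\<^sup>2 + (X / sqrt \<epsilon>) ^ 3"
  have nn: "0 \<le> 1 / sqrt \<epsilon>" "0 \<le> 2 / \<epsilon>" "0 \<le> 3 / \<epsilon>\<^sup>2" "0 \<le> (X / sqrt \<epsilon>) ^ 3"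
    using \<epsilon> X by auto
  then have K: "0 \<le> K" "1 \<le> K" "1 / sqrt \<epsilon> \<le> K" "2 / \<epsilon> \<le> K" "3 / \<epsilon>\<^sup>2 \<le> K" "(X / sqrt \<epsilon>) ^ 3 \<le> K"
    by (auto simp: K_def)
  from prod_expansion[OF order_refl K(1)] obtain C where C: "0 \<le> C"
    and expand: "\<And>a \<alpha> p q A B. 0 \<le> a \<Longrightarrow> a \<le> 1 \<Longrightarrow> factor_expansion J K a \<alpha> p q A B \<Longrightarrow>
      \<exists>w b c. product_expansion J C a \<alpha> A B w b c"
    by blast
  show ?thesis
  proof (intro exI[of _ "2 * C"] conjI allI impI)
    show "0 \<le> 2 * C" using C by simp
    fix a s :: real and y :: "'j \<Rightarrow> real"
    assume a: "0 \<le> a" "a \<le> 1" and s: "\<epsilon> \<le> s"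
    have s0: "0 < s" using s \<epsilon> by simp
    have sq: "sqrt \<epsilon> \<le> sqrt s" "0 < sqrt \<epsilon>" using s \<epsilon> by auto
    \<comment> \<open>The slope carries a minus sign because steps are subtracted from the distances
      \<open>y j\<close>.\<close>
    let ?\<alpha> = "\<lambda>j. heat s (y j)" and ?p = "\<lambda>j. - heat_x s (y j)" and ?q = "\<lambda>j. heat_xx s (y j)"
    let ?A = "\<lambda>j d. heat s (y j - a * \<xi> j d)" and ?B = "\<lambda>j. heat (s + a\<^sup>2) (y j)"
    have a3: "0 \<le> a ^ 3" using a by simp
    have "\<bar>?\<alpha> j\<bar> \<le> K" for j using heat_abs_le_1[of s "y j"] K by linarith
    moreover have "\<bar>?p j\<bar> \<le> K" for j
    proof -
      have "\<bar>?p j\<bar> \<le> 1 / sqrt \<epsilon>"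
        unfolding heat_x_def abs_minus_cancel abs_divide
        using abs_normal_density_moment_bounds(1) abs_normal_density_nonneg sq s0
        by (intro frac_le) auto
      then show ?thesis using K by linarith
    qed
    moreover have "\<bar>?q j\<bar> \<le> K" for j
    proof -
      have "\<bar>?q j\<bar> \<le> 2 / \<epsilon>"
        unfolding heat_xx_def abs_divide
        using abs_normal_density_odd_moment_bounds(1)[of "y j / sqrt s"] s s0 \<epsilon>
        by (intro frac_le) auto
      then show ?thesis using K by linarith
    qed
    moreover have "\<bar>?B j - (?\<alpha> j + a\<^sup>2 * (?q j / 2))\<bar> \<le> K * a ^ 3" for j
    proof -
      have "\<bar>?B j - (?\<alpha> j + a\<^sup>2 * (?q j / 2))\<bar> \<le> 3 * (a\<^sup>2)\<^sup>2 / s\<^sup>2"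
        using heat_time_Taylor[OF s0, of "a\<^sup>2" "y j"] by simp
      also have "\<dots> = 3 / s\<^sup>2 * (a * a ^ 3)" by (simp add: power2_eq_square power3_eq_cube)
      also have "\<dots> \<le> 3 / \<epsilon>\<^sup>2 * (1 * a ^ 3)"
        using a s s0 \<epsilon> by (intro mult_mono divide_left_mono power_mono mult_pos_pos) auto
      also have "\<dots> \<le> K * a ^ 3"
        using mult_right_mono[OF K(5) a3] by simp
      finally show ?thesis .
    qed
    moreover have "\<bar>?A j d - (?\<alpha> j + a * (\<xi> j d * ?p j) + a\<^sup>2 * ((\<xi> j d)\<^sup>2 * (?q j / 2)))\<bar> \<le> K * a ^ 3"
      if "j \<in> J" "d \<in> D" for j d
    proof -
      have "\<bar>?A j d - (?\<alpha> j + a * (\<xi> j d * ?p j) + a\<^sup>2 * ((\<xi> j d)\<^sup>2 * (?q j / 2)))\<bar>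
          \<le> (\<bar>a * \<xi> j d\<bar> / sqrt s) ^ 3"
        using heat_space_Taylor[OF s0, of "y j" "a * \<xi> j d"]
        by (simp add: power_mult_distrib algebra_simps)
      also have "\<dots> \<le> (a * X / sqrt \<epsilon>) ^ 3"
        using a X(1) X(2)[OF that] sq s0
        by (intro power_mono frac_le) (auto simp: abs_mult intro: mult_mono)
      also have "\<dots> = (X / sqrt \<epsilon>) ^ 3 * a ^ 3" by (simp add: power_mult_distrib power_divide)
      also have "\<dots> \<le> K * a ^ 3"
        using mult_right_mono[OF K(6) a3] by simp
      finally show ?thesis .
    qed
    ultimately have "factor_expansion J K a ?\<alpha> ?p ?q ?A ?B"
      by (simp only: factor_expansion_def) blast
    from expand[OF a this] obtain w b c where "product_expansion J C a ?\<alpha> ?A ?B w b c" by blast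
    then have
      1: "\<And>d. d \<in> D \<Longrightarrow> \<bar>(\<Prod>j\<in>J. ?A j d) - ((\<Prod>j\<in>J. ?\<alpha> j) + a * (\<Sum>j\<in>J. \<xi> j d * w j) + a\<^sup>2 * b d)\<bar>
            \<le> C * a ^ 3" and
      2: "(\<Sum>d\<in>D. b d) = real (card D) * c" and
      3: "\<bar>(\<Prod>j\<in>J. ?B j) - ((\<Prod>j\<in>J. ?\<alpha> j) + a\<^sup>2 * c)\<bar> \<le> C * a ^ 3"
      unfolding product_expansion_def by blast+
    let ?N = "real (card D)"
    have N: "0 < ?N" using card_D_pos by simp
    have "(\<Sum>d\<in>D. \<Sum>j\<in>J. \<xi> j d * w j) = (\<Sum>j\<in>J. (\<Sum>d\<in>D. \<xi> j d) * w j)"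
      by (subst sum.swap) (simp add: sum_distrib_right)
    also have "\<dots> = 0" by (simp add: centered)
    finally have 4: "(\<Sum>d\<in>D. \<Sum>j\<in>J. \<xi> j d * w j) = 0" .
    have "(\<Sum>d\<in>D. \<Prod>j\<in>J. ?A j d) - ?N * ((\<Prod>j\<in>J. ?\<alpha> j) + a\<^sup>2 * c)
        = (\<Sum>d\<in>D. (\<Prod>j\<in>J. ?A j d) - ((\<Prod>j\<in>J. ?\<alpha> j) + a * (\<Sum>j\<in>J. \<xi> j d * w j) + a\<^sup>2 * b d))"
    proof -
      have "(\<Sum>d\<in>D. a * (\<Sum>j\<in>J. \<xi> j d * w j)) = 0" "(\<Sum>d\<in>D. a\<^sup>2 * b d) = a\<^sup>2 * (?N * c)"
        using 2 4 by (simp_all flip: sum_distrib_left)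
      then show ?thesis by (simp add: sum_subtractf sum.distrib algebra_simps)
    qed
    also have "\<bar>\<dots>\<bar> \<le> (\<Sum>d\<in>D. C * a ^ 3)"
      by (rule order_trans[OF sum_abs sum_mono]) (rule 1)
    finally have "\<bar>(\<Sum>d\<in>D. \<Prod>j\<in>J. ?A j d) - ?N * ((\<Prod>j\<in>J. ?\<alpha> j) + a\<^sup>2 * c)\<bar> \<le> ?N * (C * a ^ 3)"
      by simp
    then have "\<bar>(\<Sum>d\<in>D. \<Prod>j\<in>J. ?A j d) - ?N * ((\<Prod>j\<in>J. ?\<alpha> j) + a\<^sup>2 * c)\<bar> / ?N \<le> C * a ^ 3"
      using N by (simp add: field_simps)
    also have "\<bar>(\<Sum>d\<in>D. \<Prod>j\<in>J. ?A j d) - ?N * ((\<Prod>j\<in>J. ?\<alpha> j) + a\<^sup>2 * c)\<bar> / ?N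
        = \<bar>((\<Sum>d\<in>D. \<Prod>j\<in>J. ?A j d) - ?N * ((\<Prod>j\<in>J. ?\<alpha> j) + a\<^sup>2 * c)) / ?N\<bar>"
      by simp
    also have "((\<Sum>d\<in>D. \<Prod>j\<in>J. ?A j d) - ?N * ((\<Prod>j\<in>J. ?\<alpha> j) + a\<^sup>2 * c)) / ?N
        = (\<Sum>d\<in>D. \<Prod>j\<in>J. ?A j d) / ?N - ((\<Prod>j\<in>J. ?\<alpha> j) + a\<^sup>2 * c)"
      using N by (simp add: diff_divide_distrib)
    finally show "\<bar>(\<Sum>d\<in>D. \<Prod>j\<in>J. ?A j d) / ?N - (\<Prod>j\<in>J. ?B j)\<bar> \<le> 2 * C * a ^ 3"
      using 3 by linarith
  qed
qed

subsection \<open>Survival probabilities\<close>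

text \<open>Recursion on the first of \<open>m\<close> independent uniform steps. Positions are
  tested after each step and not at the start, so the value for no steps is 1.\<close>

primrec survival :: "real \<Rightarrow> nat \<Rightarrow> ('j \<Rightarrow> real) \<Rightarrow> real" where
  "survival a 0 y = 1"
| "survival a (Suc m) y =
    (\<Sum>d\<in>D. if \<forall>j\<in>J. 0 \<le> y j - a * \<xi> j d then survival a m (\<lambda>j. y j - a * \<xi> j d) else 0) / real (card D)"

text \<open>Each step costs \<open>\<kappa>\<close>. When the walk leaves the orthant, the
  coordinate that left has overshot by at most \<open>a * X\<close>, so its factor is at most
  \<open>a * X / sqrt \<epsilon>\<close> in modulus, while the others are at most 1. This cost is
  not multiplied by \<open>m\<close>, since the recursion stops at the exit.\<close>

lemma survival_lower:
  assumes \<epsilon>: "0 < \<epsilon>" and X: "0 \<le> X" "\<And>j d. j \<in> J \<Longrightarrow> d \<in> D \<Longrightarrow> \<bar>\<xi> j d\<bar> \<le> X" and a: "0 \<le> a" "a \<le> 1"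
    and step: "\<And>s y. \<epsilon> \<le> s \<Longrightarrow>
      \<bar>(\<Sum>d\<in>D. \<Prod>j\<in>J. heat s (y j - a * \<xi> j d)) / real (card D) - (\<Prod>j\<in>J. heat (s + a\<^sup>2) (y j))\<bar> \<le> \<kappa>"
    and y: "\<forall>j\<in>J. 0 \<le> y j"
  shows "(\<Prod>j\<in>J. heat (\<epsilon> + m * a\<^sup>2) (y j)) - m * \<kappa> - a * X / sqrt \<epsilon> \<le> survival a m y"
  using y
proof (induction m arbitrary: y)
  case 0
  have "0 \<le> a * X / sqrt \<epsilon>" using X a \<epsilon> by simp
  moreover have "(\<Prod>j\<in>J. heat \<epsilon> (y j)) \<le> 1"
    using heat_abs_le_1 0 \<epsilon> by (intro prod_le_1) (auto simp: heat_nonneg abs_le_iff)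
  ultimately show ?case by simp
next
  case (Suc m)
  let ?N = "real (card D)"
  let ?s = "\<epsilon> + m * a\<^sup>2"
  let ?e = "m * \<kappa> + a * X / sqrt \<epsilon>"
  have N: "0 < ?N" using card_D_pos by simp
  have s: "\<epsilon> \<le> ?s" by simp
  have "(\<Prod>j\<in>J. heat ?s (y j - a * \<xi> j d)) - ?e \<le>
      (if \<forall>j\<in>J. 0 \<le> y j - a * \<xi> j d then survival a m (\<lambda>j. y j - a * \<xi> j d) else 0)" if d: "d \<in> D" for d
  proof (cases "\<forall>j\<in>J. 0 \<le> y j - a * \<xi> j d")
    case True
    then show ?thesis using Suc.IH[of "\<lambda>j. y j - a * \<xi> j d"] by simp
  next
    case False
    then obtain j where j: "j \<in> J" "y j - a * \<xi> j d < 0" by auto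
    have "\<bar>a * \<xi> j d\<bar> \<le> a * X"
      unfolding abs_mult using X(2)[OF j(1) d] a by (intro mult_mono) auto
    then have yj: "\<bar>y j - a * \<xi> j d\<bar> \<le> a * X" using j Suc.prems by force
    have "\<bar>\<Prod>j\<in>J. heat ?s (y j - a * \<xi> j d)\<bar> = \<bar>heat ?s (y j - a * \<xi> j d)\<bar>
        * (\<Prod>j\<in>J-{j}. \<bar>heat ?s (y j - a * \<xi> j d)\<bar>)"
      using finite_J j by (simp add: abs_mult abs_prod prod.remove[of J j])
    also have "\<dots> \<le> (a * X / sqrt \<epsilon>) * 1"
      using heat_abs_le[OF \<epsilon> s, of "y j - a * \<xi> j d"] divide_right_mono[OF yj, of "sqrt \<epsilon>"] \<epsilon>
      by (intro mult_mono prod_le_1) (auto simp: heat_abs_le_1 prod_nonneg)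
    finally have "(\<Prod>j\<in>J. heat ?s (y j - a * \<xi> j d)) \<le> a * X / sqrt \<epsilon>" by simp
    moreover have "0 \<le> \<kappa>" using step[of \<epsilon> y] by linarith
    ultimately show ?thesis using False by (smt (verit) mult_nonneg_nonneg of_nat_0_le_iff)
  qed
  from sum_mono[of D, OF this] have
    "((\<Sum>d\<in>D. \<Prod>j\<in>J. heat ?s (y j - a * \<xi> j d)) - ?N * ?e) / ?N \<le> survival a (Suc m) y"
    using N by (simp add: sum_subtractf divide_right_mono)
  then have "(\<Sum>d\<in>D. \<Prod>j\<in>J. heat ?s (y j - a * \<xi> j d)) / ?N - ?e \<le> survival a (Suc m) y"
    using N by (simp add: diff_divide_distrib)
  with step[OF s, of y] show ?case by (simp add: algebra_simps)
qed

text \<open>The shift by \<open>\<eta>\<close> exceeds the overshoot of one step, so the solution is still nonnegative where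
  the walk leaves the orthant.\<close>

lemma survival_upper:
  assumes \<epsilon>: "0 < \<epsilon>" and X: "0 \<le> X" "\<And>j d. j \<in> J \<Longrightarrow> d \<in> D \<Longrightarrow> \<bar>\<xi> j d\<bar> \<le> X" and a: "0 \<le> a" "a \<le> 1"
    and step: "\<And>s y. \<epsilon> \<le> s \<Longrightarrow>
      \<bar>(\<Sum>d\<in>D. \<Prod>j\<in>J. heat s (y j - a * \<xi> j d)) / real (card D) - (\<Prod>j\<in>J. heat (s + a\<^sup>2) (y j))\<bar> \<le> \<kappa>"
    and \<eta>: "0 \<le> \<eta>" "a * X \<le> \<eta>" and y: "\<forall>j\<in>J. 0 \<le> y j"
  shows "survival a m y * heat \<epsilon> \<eta> ^ card J \<le> (\<Prod>j\<in>J. heat (\<epsilon> + m * a\<^sup>2) (y j + \<eta>)) + m * \<kappa>"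
  using y
proof (induction m arbitrary: y)
  case 0
  \<comment> \<open>At the initial time \<epsilon> the shifted solution is still below 1;
    \<open>heat \<epsilon> \<eta> ^ card J\<close> is its lower bound on the orthant, hence the
    scaling of the survival probability.\<close>
  have "(\<Prod>j\<in>J. heat \<epsilon> \<eta>) \<le> (\<Prod>j\<in>J. heat \<epsilon> (y j + \<eta>))"
    using 0 \<epsilon> \<eta> by (intro prod_mono conjI heat_nonneg heat_mono) auto
  then show ?case by simp
next
  case (Suc m)
  let ?N = "real (card D)"
  let ?s = "\<epsilon> + m * a\<^sup>2"
  let ?h = "heat \<epsilon> \<eta> ^ card J"
  have N: "0 < ?N" using card_D_pos by simp
  have s: "\<epsilon> \<le> ?s" by simp
  have "(if \<forall>j\<in>J. 0 \<le> y j - a * \<xi> j d then survival a m (\<lambda>j. y j - a * \<xi> j d) else 0) * ?h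
      \<le> (\<Prod>j\<in>J. heat ?s ((y j + \<eta>) - a * \<xi> j d)) + m * \<kappa>" if d: "d \<in> D" for d
  proof (cases "\<forall>j\<in>J. 0 \<le> y j - a * \<xi> j d")
    case True
    then show ?thesis using Suc.IH[of "\<lambda>j. y j - a * \<xi> j d"] by (simp add: algebra_simps)
  next
    case False
    have "0 \<le> y j + \<eta> - a * \<xi> j d" if "j \<in> J" for j
    proof -
      have "\<bar>a * \<xi> j d\<bar> \<le> a * X"
        unfolding abs_mult using X(2)[OF that d] a by (intro mult_mono) auto
      then show ?thesis using \<eta> Suc.prems that by force
    qed
    then have "0 \<le> (\<Prod>j\<in>J. heat ?s ((y j + \<eta>) - a * \<xi> j d))"
      using s \<epsilon> by (intro prod_nonneg heat_nonneg) auto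
    moreover have "0 \<le> \<kappa>" using step[of \<epsilon> y] by linarith
    ultimately show ?thesis unfolding if_not_P[OF False] by simp
  qed
  from sum_mono[of D, OF this] have
    "(\<Sum>d\<in>D. (if \<forall>j\<in>J. 0 \<le> y j - a * \<xi> j d then survival a m (\<lambda>j. y j - a * \<xi> j d) else 0) * ?h) / ?N
      \<le> ((\<Sum>d\<in>D. \<Prod>j\<in>J. heat ?s ((y j + \<eta>) - a * \<xi> j d)) + ?N * (m * \<kappa>)) / ?N"
    using N by (simp add: sum.distrib divide_right_mono)
  then have "survival a (Suc m) y * ?h
      \<le> (\<Sum>d\<in>D. \<Prod>j\<in>J. heat ?s ((y j + \<eta>) - a * \<xi> j d)) / ?N + m * \<kappa>"
    using N by (simp add: add_divide_distrib flip: sum_distrib_right)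
  with step[OF s, of "\<lambda>j. y j + \<eta>"] show ?case by (simp add: algebra_simps)
qed

text \<open>With steps of scale \<open>1 / sqrt n\<close> the elapsed time is 1 and the
  \<open>n\<close> step errors add up to \<open>C / sqrt n\<close>. For fixed \<epsilon> the limit
  in \<open>n\<close> comes first and leaves two bounds free of \<open>n\<close>; then an \<epsilon>
  is selected that brings them close to the claimed limit.\<close>

theorem survival_tendsto:
  assumes t: "0 \<le> t"
  shows "(\<lambda>n. survival (1 / sqrt (real n)) n (\<lambda>_. t)) \<longlonglongrightarrow> abs_normal_cdf t ^ card J"
proof -
  obtain X where X: "1 \<le> X" "\<And>j d. j \<in> J \<Longrightarrow> d \<in> D \<Longrightarrow> \<bar>\<xi> j d\<bar> \<le> X"
    using steps_bounded by blast
  let ?Q = "\<lambda>n. survival (1 / sqrt (real n)) n (\<lambda>_. t)"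
  let ?L = "abs_normal_cdf t ^ card J"
  have a_lim: "(\<lambda>n. 1 / sqrt (real n)) \<longlonglongrightarrow> 0"
    by real_asymp
  have lower: "\<exists>r. r \<longlonglongrightarrow> abs_normal_cdf (t / sqrt (1 + \<epsilon>)) ^ card J \<and> (\<forall>n\<ge>1. r n \<le> ?Q n)"
    and upper: "\<exists>r. r \<longlonglongrightarrow> abs_normal_cdf ((t + \<epsilon> powr (1/4)) / sqrt (1 + \<epsilon>)) ^ card J
      / abs_normal_cdf (1 / \<epsilon> powr (1/4)) ^ card J
      \<and> (\<forall>\<^sub>F n in sequentially. ?Q n \<le> r n)" if \<epsilon>: "0 < \<epsilon>" for \<epsilon>
  proof -
    obtain C where C: "\<And>a s y. 0 \<le> a \<Longrightarrow> a \<le> 1 \<Longrightarrow> \<epsilon> \<le> s \<Longrightarrow>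
      \<bar>(\<Sum>d\<in>D. \<Prod>j\<in>J. heat s (y j - a * \<xi> j d)) / real (card D) - (\<Prod>j\<in>J. heat (s + a\<^sup>2) (y j))\<bar> \<le> C * a ^ 3"
      using heat_step[OF \<epsilon>] by blast
    have *: "real n * (C * (1 / sqrt (real n)) ^ 3) = C * (1 / sqrt (real n))"
      "real n * (1 / sqrt (real n))\<^sup>2 = 1" "1 / sqrt (real n) \<le> 1" if "1 \<le> n" for n
      using that by (auto simp: power3_eq_cube field_simps)
    let ?r = "\<lambda>n. abs_normal_cdf (t / sqrt (1 + \<epsilon>)) ^ card J - C * (1 / sqrt (real n)) - 1 / sqrt (real n) * X / sqrt \<epsilon>"
    have "?r \<longlonglongrightarrow> abs_normal_cdf (t / sqrt (1 + \<epsilon>)) ^ card J - C * 0 - 0 * X / sqrt \<epsilon>"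
      using \<epsilon> by (intro tendsto_intros a_lim) auto
    moreover have "?r n \<le> ?Q n" if "1 \<le> n" for n
      using survival_lower[OF \<epsilon> _ X(2) _ *(3)[OF that] C, of "\<lambda>_. t" n] that t X(1) *[OF that]
      by (simp add: heat_def add.commute)
    ultimately show "\<exists>r. r \<longlonglongrightarrow> abs_normal_cdf (t / sqrt (1 + \<epsilon>)) ^ card J \<and> (\<forall>n\<ge>1. r n \<le> ?Q n)"
      by (intro exI[of _ ?r]) simp
    \<comment> \<open>this exponent gives both \<open>\<eta> \<rightarrow> 0\<close> and \<open>\<eta> / sqrt \<epsilon> \<rightarrow> \<infinity>\<close>\<close>
    define \<eta> where "\<eta> = \<epsilon> powr (1/4)"
    have \<eta>: "0 < \<eta>" using \<epsilon> by (simp add: \<eta>_def)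
    have "\<eta> * \<eta> = \<epsilon> powr (1/2)" unfolding \<eta>_def by (simp flip: powr_add)
    then have "sqrt \<epsilon> = \<eta> * \<eta>" using \<epsilon> by (simp add: powr_half_sqrt)
    then have h: "heat \<epsilon> \<eta> = abs_normal_cdf (1 / \<eta>)" using \<eta> by (simp add: heat_def)
    let ?h = "abs_normal_cdf (1 / \<eta>) ^ card J"
    have hpos: "0 < ?h" using \<eta> by (simp add: abs_normal_cdf_pos)
    let ?r = "\<lambda>n. (abs_normal_cdf ((t + \<eta>) / sqrt (1 + \<epsilon>)) ^ card J + C * (1 / sqrt (real n))) / ?h"
    have "?r \<longlonglongrightarrow> (abs_normal_cdf ((t + \<eta>) / sqrt (1 + \<epsilon>)) ^ card J + C * 0) / ?h"
      by (intro tendsto_intros a_lim less_imp_neq[OF hpos, symmetric])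
    moreover have "\<forall>\<^sub>F n in sequentially. ?Q n \<le> ?r n"
    proof -
      \<comment> \<open>For large \<open>n\<close> the overshoot of one step falls below the fixed
        shift \<open>\<eta>\<close>, as \<open>survival_upper\<close> requires.\<close>
      have "(\<lambda>n. 1 / sqrt (real n) * X) \<longlonglongrightarrow> 0 * X" by (intro tendsto_intros a_lim)
      then have "\<forall>\<^sub>F n in sequentially. 1 / sqrt (real n) * X < \<eta>"
        using \<eta> by (intro order_tendstoD(2)) auto
      then show ?thesis using eventually_ge_at_top[of 1]
      proof eventually_elim
        case (elim n)
        then have "?Q n * ?h \<le> abs_normal_cdf ((t + \<eta>) / sqrt (1 + \<epsilon>)) ^ card J + C * (1 / sqrt (real n))"
          using survival_upper[OF \<epsilon> _ X(2) _ *(3) C, of n \<eta> "\<lambda>_. t" n] t X(1) *[OF elim(2)] \<eta>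
          by (simp add: h) (simp add: heat_def add.commute)
        then show ?case using hpos by (simp add: pos_le_divide_eq)
      qed
    qed
    ultimately show "\<exists>r. r \<longlonglongrightarrow> abs_normal_cdf ((t + \<epsilon> powr (1/4)) / sqrt (1 + \<epsilon>)) ^ card J
      / abs_normal_cdf (1 / \<epsilon> powr (1/4)) ^ card J
      \<and> (\<forall>\<^sub>F n in sequentially. ?Q n \<le> r n)"
      by (intro exI[of _ ?r]) (simp add: \<eta>_def)
  qed
  have low: "((\<lambda>\<epsilon>. abs_normal_cdf (t / sqrt (1 + \<epsilon>)) ^ card J) \<longlongrightarrow> ?L) (at_right 0)"
  proof -
    have "((\<lambda>\<epsilon>. t / sqrt (1 + \<epsilon>)) \<longlongrightarrow> t) (at_right 0)" by real_asymp
    then show ?thesis by (intro tendsto_intros isCont_tendsto_compose[OF isCont_abs_normal_cdf])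
  qed
  have up: "((\<lambda>\<epsilon>. abs_normal_cdf ((t + \<epsilon> powr (1/4)) / sqrt (1 + \<epsilon>)) ^ card J
      / abs_normal_cdf (1 / \<epsilon> powr (1/4)) ^ card J)
      \<longlongrightarrow> ?L) (at_right 0)"
  proof -
    have 1: "((\<lambda>\<epsilon>. (t + \<epsilon> powr (1/4)) / sqrt (1 + \<epsilon>)) \<longlongrightarrow> t) (at_right 0)" by real_asymp
    \<comment> \<open>This sends the normalising denominator to 1.\<close>
    have 2: "filterlim (\<lambda>\<epsilon>::real. 1 / \<epsilon> powr (1/4)) at_top (at_right 0)" by real_asymp
    have "((\<lambda>\<epsilon>. abs_normal_cdf ((t + \<epsilon> powr (1/4)) / sqrt (1 + \<epsilon>)) ^ card J
      / abs_normal_cdf (1 / \<epsilon> powr (1/4)) ^ card J)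
      \<longlongrightarrow> ?L / 1 ^ card J) (at_right 0)"
      by (intro tendsto_intros isCont_tendsto_compose[OF isCont_abs_normal_cdf] 1
        filterlim_compose[OF abs_normal_cdf_at_top 2]) simp
    then show ?thesis by simp
  qed
  show ?thesis
  proof (rule order_tendstoI)
    fix l assume "l < ?L"
    with low have "\<forall>\<^sub>F \<epsilon> in at_right 0. l < abs_normal_cdf (t / sqrt (1 + \<epsilon>)) ^ card J"
      by (rule order_tendstoD(1))
    then have "\<forall>\<^sub>F \<epsilon> in at_right (0::real). l < abs_normal_cdf (t / sqrt (1 + \<epsilon>)) ^ card J \<and> 0 < \<epsilon>"
      using eventually_at_right_less[of "0::real"] by eventually_elim simp
    then obtain \<epsilon> where \<epsilon>: "0 < \<epsilon>" "l < abs_normal_cdf (t / sqrt (1 + \<epsilon>)) ^ card J"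
      using eventually_happens'[OF trivial_limit_at_right_real] by blast
    from lower[OF \<epsilon>(1)] obtain r where r: "r \<longlonglongrightarrow> abs_normal_cdf (t / sqrt (1 + \<epsilon>)) ^ card J" "\<forall>n\<ge>1. r n \<le> ?Q n"
      by blast
    have "\<forall>\<^sub>F n in sequentially. l < r n" using r(1) \<epsilon>(2) by (rule order_tendstoD(1))
    then show "\<forall>\<^sub>F n in sequentially. l < ?Q n" using eventually_ge_at_top[of 1]
      by eventually_elim (use r(2) in fastforce)
  next
    fix u assume "?L < u"
    let ?g = "\<lambda>\<epsilon>. abs_normal_cdf ((t + \<epsilon> powr (1/4)) / sqrt (1 + \<epsilon>)) ^ card J
      / abs_normal_cdf (1 / \<epsilon> powr (1/4)) ^ card J"
    from up \<open>?L < u\<close> have "\<forall>\<^sub>F \<epsilon> in at_right 0. ?g \<epsilon> < u"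
      by (rule order_tendstoD(2))
    then have "\<forall>\<^sub>F \<epsilon> in at_right (0::real). ?g \<epsilon> < u \<and> 0 < \<epsilon>"
      using eventually_at_right_less[of "0::real"] by eventually_elim simp
    then obtain \<epsilon> where \<epsilon>: "0 < \<epsilon>" "?g \<epsilon> < u"
      using eventually_happens'[OF trivial_limit_at_right_real] by blast
    from upper[OF \<epsilon>(1)] obtain r where r: "r \<longlonglongrightarrow> ?g \<epsilon>" "\<forall>\<^sub>F n in sequentially. ?Q n \<le> r n"
      by blast
    have "\<forall>\<^sub>F n in sequentially. r n < u" using r(1) \<epsilon>(2) by (rule order_tendstoD(2))
    then show "\<forall>\<^sub>F n in sequentially. ?Q n < u" using r(2)
      by eventually_elim linarith
  qed
qed

end

section \<open>From the walk to the statistic\<close>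

context orthonormal_steps
begin

text \<open>A path is given by the list of its directions. The index starts at 1 because
  \<open>survival\<close> does not test the starting point either.\<close>

definition stays_nonneg :: "real \<Rightarrow> ('j \<Rightarrow> real) \<Rightarrow> 'd list \<Rightarrow> bool" where
  "stays_nonneg a y l \<longleftrightarrow>
    (\<forall>m\<in>{1..length l}. \<forall>j\<in>J. 0 \<le> y j - a * sum_list (map (\<xi> j) (take m l)))"

lemma stays_nonneg_Cons:
  "stays_nonneg a y (d # l) \<longleftrightarrow>
    (\<forall>j\<in>J. 0 \<le> y j - a * \<xi> j d) \<and> stays_nonneg a (\<lambda>j. y j - a * \<xi> j d) l"
proof -
  have *: "{1..length (d # l)} = insert 1 (Suc ` {1..length l})"
    by (auto simp: image_Suc_atLeastAtMost)
  show ?thesis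
    unfolding stays_nonneg_def * by (simp del: image_Suc_atLeastAtMost add: algebra_simps)
qed

text \<open>Splitting off the head of the list reproduces the recursion of \<open>survival\<close>,
  which is thereby the proportion of lists that stay in the orthant.\<close>

lemma card_stays_nonneg:
  "real (card {l. set l \<subseteq> D \<and> length l = n \<and> stays_nonneg a y l}) = real (card D) ^ n * survival a n y"
proof (induction n arbitrary: y)
  case 0
  have "{l. set l \<subseteq> D \<and> length l = 0 \<and> stays_nonneg a y l} = {[]}"
    by (auto simp: stays_nonneg_def)
  then show ?case by simp
next
  case (Suc n)
  let ?G = "\<lambda>n y. {l. set l \<subseteq> D \<and> length l = n \<and> stays_nonneg a y l}"
  let ?y = "\<lambda>d j. y j - a * \<xi> j d"
  let ?H = "\<lambda>d. if \<forall>j\<in>J. 0 \<le> ?y d j then ?G n (?y d) else {}"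
  have fin: "finite (?G n y)" for y
    by (rule finite_subset[OF _ finite_lists_length_eq[OF finite_D, of n]]) auto
  have "?G (Suc n) y = (\<lambda>(d, l). d # l) ` (SIGMA d:D. ?H d)"
  proof (intro equalityI subsetI)
    fix l assume l: "l \<in> ?G (Suc n) y"
    then obtain d l' where "l = d # l'" by (cases l) auto
    with l show "l \<in> (\<lambda>(d, l). d # l) ` (SIGMA d:D. ?H d)"
      by (auto simp: stays_nonneg_Cons intro!: image_eqI[of _ _ "(d, l')"])
  qed (auto simp: stays_nonneg_Cons split: if_splits)
  then have "card (?G (Suc n) y) = card (SIGMA d:D. ?H d)"
    by (simp add: card_image inj_on_def)
  also have "\<dots> = (\<Sum>d\<in>D. card (?H d))"
    using fin finite_D by (intro card_SigmaI) auto
  finally have "real (card (?G (Suc n) y)) = (\<Sum>d\<in>D. real (card (?H d)))" by simp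
  also have "\<dots> = (\<Sum>d\<in>D. real (card D) ^ n *
      (if \<forall>j\<in>J. 0 \<le> ?y d j then survival a n (?y d) else 0))"
    by (intro sum.cong refl) (simp add: Suc.IH)
  also have "\<dots> = real (card D) ^ n * (real (card D) * survival a (Suc n) y)"
    using card_D_pos by (simp flip: sum_distrib_left)
  finally show ?case by simp
qed

end

section \<open>Helmert contrasts as the steps of the walk\<close>

definition contrast_step :: "nat \<Rightarrow> nat \<Rightarrow> nat \<Rightarrow> real" where
  "contrast_step k j d = sqrt (contrast_const k j) * (of_bool (d = j) - of_bool (d < j) / (real j - 1))"

text \<open>For \<open>i < j\<close>, step \<open>i\<close> is supported on
  \<open>d \<le> i\<close>, where step \<open>j\<close> is constant, so orthogonality reduces to
  centring. The factor \<open>contrast_const k j\<close> is such that its product with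
  \<open>1 + 1 / (j - 1)\<close>, the squared length, is \<open>k\<close>.\<close>

lemma orthonormal_contrast_step:
  assumes "1 \<le> k"
  shows "orthonormal_steps {1..k} {2..k} (contrast_step k)"
proof
  have lt: "(\<Sum>d=1..k. of_bool (d < j)) = real j - 1" if "j \<in> {2..k}" for j
  proof -
    have "(\<Sum>d=1..k. of_bool (d < j)) = (\<Sum>d\<in>{1..<j}. 1 :: real)"
      using that by (intro sum.mono_neutral_cong_right) auto
    then show ?thesis using that by simp
  qed
  have eq: "(\<Sum>d=1..k. of_bool (d = j)) = (1 :: real)" if "j \<in> {2..k}" for j
  proof -
    have "(\<Sum>d=1..k. of_bool (d = j)) = (\<Sum>d\<in>{j}. 1 :: real)"
      using that by (intro sum.mono_neutral_cong_right) auto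
    then show ?thesis by simp
  qed
  show centered: "(\<Sum>d=1..k. contrast_step k j d) = 0" if "j \<in> {2..k}" for j
    using that lt[OF that] eq[OF that]
    by (simp del: sum_of_bool_eq add: contrast_step_def sum_subtractf flip: sum_distrib_left sum_divide_distrib)
  have less: "(\<Sum>d=1..k. contrast_step k i d * contrast_step k j d) = 0"
    if "i \<in> {2..k}" "j \<in> {2..k}" "i < j" for i j
  proof -
    have "contrast_step k i d * contrast_step k j d
        = contrast_step k i d * (- sqrt (contrast_const k j) / (real j - 1))" for d
      using that(3) by (cases "d \<le> i") (auto simp: contrast_step_def)
    then show ?thesis
      using centered[OF that(1)] by (simp only: sum_distrib_right[symmetric] mult_zero_left)
  qed
  show "(\<Sum>d=1..k. contrast_step k i d * contrast_step k j d)
      = (if i = j then real (card {1..k}) else 0)" if ij: "i \<in> {2..k}" "j \<in> {2..k}" for i j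
  proof (cases "i = j")
    case True
    have c: "0 \<le> contrast_const k j" using ij by (simp add: contrast_const_def)
    have "contrast_step k j d * contrast_step k j d =
        contrast_const k j * (of_bool (d = j) + of_bool (d < j) / (real j - 1)\<^sup>2)" for d
      using c by (auto simp: contrast_step_def power2_eq_square)
    then have "(\<Sum>d=1..k. contrast_step k j d * contrast_step k j d)
        = contrast_const k j * (1 + (real j - 1) / (real j - 1)\<^sup>2)"
      using ij lt[OF ij(2)] eq[OF ij(2)]
      by (simp del: sum_of_bool_eq add: sum.distrib flip: sum_distrib_left sum_divide_distrib)
    also have "\<dots> = real k"
    proof -
      define x where "x = real j - 1"
      have x: "0 < x" "real j = x + 1" using ij by (auto simp: x_def)
      then have "1 + x / x\<^sup>2 = (x + 1) / x" by (simp add: power2_eq_square field_simps)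
      then show ?thesis using x by (simp add: contrast_const_def)
    qed
    finally show ?thesis using True by simp
  next
    case False
    then consider "i < j" | "j < i" by linarith
    then show ?thesis
      using less[OF ij] less[OF ij(2,1)] False by cases (simp_all add: mult.commute)
  qed
qed (use assms in auto)

section \<open>The contrast process as a sum of steps over the observations\<close>

lemma contrast_process_eq:
  assumes d: "\<And>i. i \<in> {1..n} \<Longrightarrow> 1 \<le> \<delta>s i \<omega>" and j: "2 \<le> j"
  shows "contrast_process k Ts \<delta>s n j \<omega> x
    = 1 / sqrt (real n) * (\<Sum>i\<in>{i\<in>{1..n}. Ts i \<omega> \<le> x}. contrast_step k j (\<delta>s i \<omega>))"
proof -
  let ?S = "{i\<in>{1..n}. Ts i \<omega> \<le> x}"
  have e: "emp_cum_inc Ts \<delta>s n l \<omega> x = (1 / real n) * (\<Sum>i\<in>?S. of_bool (\<delta>s i \<omega> = l))" for l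
    unfolding emp_cum_inc_def
    by (intro arg_cong2[where f = "(*)"] refl sum.mono_neutral_cong_right) auto
  \<comment> \<open>The sum over \<open>l\<close> starts at 1, so it captures every cause below
    \<open>j\<close> because causes are at least 1.\<close>
  have "(\<Sum>l=1..j-1. of_bool (\<delta>s i \<omega> = l)) = (of_bool (\<delta>s i \<omega> < j) :: real)" if "i \<in> {1..n}" for i
  proof (cases "\<delta>s i \<omega> < j")
    case True
    then have "(\<Sum>l=1..j-1. of_bool (\<delta>s i \<omega> = l)) = (\<Sum>l\<in>{\<delta>s i \<omega>}. 1 :: real)"
      using d[OF that] by (intro sum.mono_neutral_cong_right) auto
    then show ?thesis using True by simp
  next
    case False
    then show ?thesis using j by (auto intro!: sum.neutral)
  qed
  then have "(\<Sum>l=1..j-1. emp_cum_inc Ts \<delta>s n l \<omega> x) = (1 / real n) * (\<Sum>i\<in>?S. of_bool (\<delta>s i \<omega> < j))"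
    unfolding e sum_distrib_left[symmetric] by (subst sum.swap) simp
  then have "contrast_process k Ts \<delta>s n j \<omega> x = (sqrt (real n) / real n) * (sqrt (contrast_const k j) *
      ((\<Sum>i\<in>?S. of_bool (\<delta>s i \<omega> = j)) - (\<Sum>i\<in>?S. of_bool (\<delta>s i \<omega> < j)) / (real j - 1)))"
    unfolding contrast_process_def e by (simp add: algebra_simps)
  \<comment> \<open>For \<open>n = 0\<close> both quotients are 0, division by zero having the value
    0.\<close>
  also have "sqrt (real n) / real n = 1 / sqrt (real n)"
    by (cases "n = 0") (simp_all add: field_simps)
  also have "sqrt (contrast_const k j) *
      ((\<Sum>i\<in>?S. of_bool (\<delta>s i \<omega> = j)) - (\<Sum>i\<in>?S. of_bool (\<delta>s i \<omega> < j)) / (real j - 1))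
      = (\<Sum>i\<in>?S. contrast_step k j (\<delta>s i \<omega>))"
    by (simp del: sum_of_bool_eq add: contrast_step_def sum_subtractf sum_distrib_left sum_divide_distrib right_diff_distrib)
  finally show ?thesis .
qed

text \<open>The path only changes at the observation times, so \<open>x = 0\<close> and those times suffice.\<close>

lemma contrast_process_image:
  "contrast_process k Ts \<delta>s n j \<omega> ` {0..}
    = contrast_process k Ts \<delta>s n j \<omega> ` insert 0 {x. \<exists>i\<in>{1..n}. x = Ts i \<omega> \<and> 0 \<le> x}" (is "?f ` _ = ?f ` ?G")
proof (intro equalityI image_subsetI)
  fix x :: real assume "x \<in> {0..}"
  have cong: "?f x = ?f x'" if "\<And>i. i \<in> {1..n} \<Longrightarrow> Ts i \<omega> \<le> x \<longleftrightarrow> Ts i \<omega> \<le> x'" for x x'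
    unfolding contrast_process_def emp_cum_inc_def using that
    by (intro arg_cong2[where f = "(*)"] arg_cong2[where f = "(-)"] refl sum.cong) auto
  \<comment> \<open>The last candidate point at or before \<open>x\<close>; the point 0 guarantees
    that one exists. Observations with negative times lie below it anyway, so \<open>x\<close> and
    \<open>?x\<close> see the same observations.\<close>
  let ?x = "Max {y\<in>?G. y \<le> x}"
  have "?G = insert 0 ((\<lambda>i. Ts i \<omega>) ` {1..n} \<inter> {0..})" by auto
  then have fin: "finite ?G" by simp
  then have "?x \<in> {y\<in>?G. y \<le> x}" using \<open>x \<in> {0..}\<close> by (intro Max_in) auto
  moreover have "Ts i \<omega> \<le> ?x" if "i \<in> {1..n}" "Ts i \<omega> \<le> x" for i
  proof (cases "0 \<le> Ts i \<omega>")
    case True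
    then show ?thesis using that fin by (intro Max_ge) auto
  next
    case False
    have "0 \<le> ?x" using fin \<open>x \<in> {0..}\<close> by (intro Max_ge) auto
    then show ?thesis using False by simp
  qed
  ultimately have "?f x = ?f ?x" by (intro cong) force
  then show "?f x \<in> ?f ` ?G" using \<open>?x \<in> {y\<in>?G. y \<le> x}\<close> by blast
qed auto

text \<open>All values of a path are taken at finitely many points, so the supremum is a maximum.
  The resulting finite list of inequalities also gives measurability.\<close>

lemma max_sup_stat_le_iff:
  assumes k: "2 \<le> k"
  shows "max_sup_stat k Ts \<delta>s n \<omega> \<le> t \<longleftrightarrow>
    (\<forall>j\<in>{2..k}. contrast_process k Ts \<delta>s n j \<omega> 0 \<le> t \<and>
      (\<forall>i\<in>{1..n}. 0 \<le> Ts i \<omega> \<longrightarrow> contrast_process k Ts \<delta>s n j \<omega> (Ts i \<omega>) \<le> t))"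
proof -
  have "(SUP x\<in>{0..}. contrast_process k Ts \<delta>s n j \<omega> x) \<le> t \<longleftrightarrow>
      contrast_process k Ts \<delta>s n j \<omega> 0 \<le> t \<and>
      (\<forall>i\<in>{1..n}. 0 \<le> Ts i \<omega> \<longrightarrow> contrast_process k Ts \<delta>s n j \<omega> (Ts i \<omega>) \<le> t)" for j
  proof -
    let ?G = "insert 0 {x. \<exists>i\<in>{1..n}. x = Ts i \<omega> \<and> 0 \<le> x}"
    have "?G = insert 0 ((\<lambda>i. Ts i \<omega>) ` {1..n} \<inter> {0..})" by auto
    then have fin: "finite ?G" by simp
    then have "(SUP x\<in>{0..}. contrast_process k Ts \<delta>s n j \<omega> x) = Max (contrast_process k Ts \<delta>s n j \<omega> ` ?G)"
      unfolding contrast_process_image by (intro cSup_eq_Max) auto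
    then show ?thesis using fin by auto
  qed
  then show ?thesis using k unfolding max_sup_stat_def by (subst Max_le_iff) auto
qed

text \<open>Transfers the statistic to the space of time vectors, with the causes held
  fixed.\<close>

lemma max_sup_stat_cong:
  assumes "\<And>i. i \<in> {1..n} \<Longrightarrow> Ts i \<omega> = Ts' i \<omega>'" "\<And>i. i \<in> {1..n} \<Longrightarrow> \<delta>s i \<omega> = \<delta>s' i \<omega>'"
  shows "max_sup_stat k Ts \<delta>s n \<omega> = max_sup_stat k Ts' \<delta>s' n \<omega>'"
proof -
  have "contrast_process k Ts \<delta>s n j \<omega> x = contrast_process k Ts' \<delta>s' n j \<omega>' x" for j x
    unfolding contrast_process_def emp_cum_inc_def using assms
    by (intro arg_cong2[where f = "(*)"] arg_cong2[where f = "(-)"] refl sum.cong) auto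
  then show ?thesis by (simp add: max_sup_stat_def)
qed

lemma measurable_max_sup_stat:
  assumes k: "2 \<le> k"
    and T [measurable]: "\<And>i. i \<in> {1..n} \<Longrightarrow> Ts i \<in> borel_measurable M"
    and \<delta> [measurable]: "\<And>i. i \<in> {1..n} \<Longrightarrow> \<delta>s i \<in> measurable M (count_space UNIV)"
  shows "max_sup_stat k Ts \<delta>s n \<in> borel_measurable M"
proof (rule borel_measurable_iff_le[THEN iffD2], intro allI)
  fix t
  \<comment> \<open>\<open>g\<close> is the constant 0 or one of the random times, at which the path
    is evaluated.\<close>
  have [measurable]: "(\<lambda>\<omega>. contrast_process k Ts \<delta>s n j \<omega> (g \<omega>)) \<in> borel_measurable M"
    if [measurable]: "g \<in> borel_measurable M" for g j
    unfolding contrast_process_def emp_cum_inc_def by measurable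
  show "{\<omega> \<in> space M. max_sup_stat k Ts \<delta>s n \<omega> \<le> t} \<in> sets M"
    unfolding max_sup_stat_le_iff[OF k] by measurable
qed

text \<open>Sorted by time, the causes become the directions of the walk. Since the times are
  distinct, the observations up to the m-th smallest time are the first m of the sorted list, so the
  path runs through the partial sums.\<close>

lemma max_sup_stat_le_iff_stays_nonneg:
  assumes k: "2 \<le> k" and t: "0 \<le> t"
    and inj: "inj_on (\<lambda>i. Ts i \<omega>) {1..n}"
    and T: "\<And>i. i \<in> {1..n} \<Longrightarrow> 0 \<le> Ts i \<omega>" and d: "\<And>i. i \<in> {1..n} \<Longrightarrow> 1 \<le> \<delta>s i \<omega>"
  shows "max_sup_stat k Ts \<delta>s n \<omega> \<le> t \<longleftrightarrow>
    orthonormal_steps.stays_nonneg {2..k} (contrast_step k) (1 / sqrt (real n)) (\<lambda>_. t)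
      (map (\<lambda>i. \<delta>s i \<omega>) (sort_key (\<lambda>i. Ts i \<omega>) [1..<Suc n]))"
proof -
  interpret orthonormal_steps "{1..k}" "{2..k}" "contrast_step k"
    using k by (intro orthonormal_contrast_step) simp
  define js where "js = sort_key (\<lambda>i. Ts i \<omega>) [1..<Suc n]"
  have js: "set js = {1..n}" "distinct js" "length js = n"
    by (auto simp: js_def)
  have sorted: "sorted (map (\<lambda>i. Ts i \<omega>) js)" by (simp add: js_def)
  have below: "{i\<in>{1..n}. Ts i \<omega> \<le> Ts (js ! m) \<omega>} = set (take (Suc m) js)" if "m < n" for m
  proof (intro equalityI subsetI)
    fix i assume i: "i \<in> {i\<in>{1..n}. Ts i \<omega> \<le> Ts (js ! m) \<omega>}"
    then have "i \<in> set js" using js by simp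
    then obtain p where p: "p < n" "i = js ! p" using js(3) by (metis in_set_conv_nth)
    have "p \<le> m"
    proof (rule ccontr)
      assume "\<not> p \<le> m"
      then have "Ts (js ! m) \<omega> \<le> Ts i \<omega>"
        using sorted p js by (auto simp: sorted_iff_nth_mono)
      \<comment> \<open>A tie between different positions contradicts injectivity.\<close>
      with i have "Ts (js ! m) \<omega> = Ts i \<omega>" by simp
      moreover have "js ! m \<in> {1..n}" using js that nth_mem by metis
      ultimately have "js ! m = js ! p" using inj_onD[OF inj] i p by blast
      then show False using p js that \<open>\<not> p \<le> m\<close> by (simp add: nth_eq_iff_index_eq)
    qed
    then show "i \<in> set (take (Suc m) js)" using p js by (auto simp: in_set_conv_nth)
  next
    fix i assume "i \<in> set (take (Suc m) js)"
    then obtain p where p: "p \<le> m" "i = js ! p" using that js by (auto simp: in_set_conv_nth less_Suc_eq_le)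
    then have "Ts i \<omega> \<le> Ts (js ! m) \<omega>" using sorted js that by (auto simp: sorted_iff_nth_mono)
    then show "i \<in> {i\<in>{1..n}. Ts i \<omega> \<le> Ts (js ! m) \<omega>}"
      using p that js nth_mem[of p js] by auto
  qed
  let ?f = "contrast_process k Ts \<delta>s n"
  have f: "?f j \<omega> (Ts (js ! m) \<omega>) =
      1 / sqrt (real n) * sum_list (map (contrast_step k j) (take (Suc m) (map (\<lambda>i. \<delta>s i \<omega>) js)))"
    if "j \<in> {2..k}" "m < n" for j m
  proof -
    have "?f j \<omega> (Ts (js ! m) \<omega>) = 1 / sqrt (real n) * (\<Sum>i\<in>set (take (Suc m) js). contrast_step k j (\<delta>s i \<omega>))"
      using d that unfolding below[OF that(2), symmetric] by (intro contrast_process_eq) auto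
    also have "(\<Sum>i\<in>set (take (Suc m) js). contrast_step k j (\<delta>s i \<omega>))
        = sum_list (map (contrast_step k j) (take (Suc m) (map (\<lambda>i. \<delta>s i \<omega>) js)))"
      using js by (subst sum_list_distinct_conv_sum_set[symmetric]) (auto simp: take_map comp_def)
    finally show ?thesis .
  qed
  \<comment> \<open>The statistic also inspects the point 0, which is no step of the walk: unless
    some observation is 0, the path is 0 there, and \<open>0 \<le> t\<close>.\<close>
  have zero: "?f j \<omega> 0 \<le> t" if j: "j \<in> {2..k}" and all: "\<forall>i\<in>{1..n}. ?f j \<omega> (Ts i \<omega>) \<le> t" for j
  proof (cases "\<exists>i\<in>{1..n}. Ts i \<omega> = 0")
    case True
    then show ?thesis using all by force
  next
    case False
    then have "{i\<in>{1..n}. Ts i \<omega> \<le> 0} = {}" using T by force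
    then show ?thesis using contrast_process_eq[where \<delta>s = \<delta>s and \<omega> = \<omega> and n = n and j = j] d j t
      by (simp del: Collect_empty_eq)
  qed
  have "max_sup_stat k Ts \<delta>s n \<omega> \<le> t \<longleftrightarrow> (\<forall>j\<in>{2..k}. \<forall>i\<in>{1..n}. ?f j \<omega> (Ts i \<omega>) \<le> t)"
    unfolding max_sup_stat_le_iff[OF k] using T zero by blast
  also have "\<dots> \<longleftrightarrow> (\<forall>j\<in>{2..k}. \<forall>m\<in>{..<n}. ?f j \<omega> (Ts (js ! m) \<omega>) \<le> t)"
  proof -
    have "{1..n} = (\<lambda>m. js ! m) ` {..<n}"
      using js by (auto simp: set_conv_nth)
    then show ?thesis by simp
  qed
  also have "\<dots> \<longleftrightarrow> (\<forall>m\<in>{1..n}. \<forall>j\<in>{2..k}. 0 \<le> t -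
      1 / sqrt (real n) * sum_list (map (contrast_step k j) (take m (map (\<lambda>i. \<delta>s i \<omega>) js))))"
  proof -
    have "{1..n} = Suc ` {..<n}" by (auto simp: image_iff Bex_def) presburger
    then show ?thesis using f by auto
  qed
  finally show ?thesis unfolding stays_nonneg_def js_def[symmetric] by (simp add: js)
qed

section \<open>Counting cause assignments for fixed times\<close>

lemma bij_betw_map_distinct:
  assumes "distinct js"
  shows "bij_betw (\<lambda>d. map d js) (set js \<rightarrow>\<^sub>E D) {l. set l \<subseteq> D \<and> length l = length js}"
proof (rule bij_betw_imageI)
  show "inj_on (\<lambda>d. map d js) (set js \<rightarrow>\<^sub>E D)"
    by (intro inj_onI PiE_ext) (auto simp: map_eq_conv)
  show "(\<lambda>d. map d js) ` (set js \<rightarrow>\<^sub>E D) = {l. set l \<subseteq> D \<and> length l = length js}"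
  proof (intro equalityI subsetI)
    fix l assume l: "l \<in> {l. set l \<subseteq> D \<and> length l = length js}"
    \<comment> \<open>The preimage gives each entry of \<open>js\<close> the entry of
      \<open>l\<close> at the same position, and is undefined off \<open>set js\<close> as
      \<open>\<rightarrow>\<^sub>E\<close> demands.\<close>
    define d where "d = restrict (the \<circ> map_of (zip js l)) (set js)"
    have v: "d (js ! m) = l ! m" if "m < length js" for m
      using that l assms by (simp add: d_def map_of_zip_nth)
    then have "map d js = l" using l by (intro nth_equalityI) auto
    moreover have "d \<in> set js \<rightarrow>\<^sub>E D"
    proof (rule PiE_I)
      fix i assume "i \<in> set js"
      then obtain m where "m < length js" "i = js ! m" by (metis in_set_conv_nth)
      then show "d i \<in> D" using v[of m] l nth_mem[of m l] by auto
    qed (simp add: d_def)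
    ultimately show "l \<in> (\<lambda>d. map d js) ` (set js \<rightarrow>\<^sub>E D)" by blast
  qed auto
qed

text \<open>The times only decide in which order an assignment is read, and reading along any order
  is a bijection onto lists. Hence the count is the same for all vectors of distinct nonnegative
  times.\<close>

lemma card_max_sup_stat_le:
  assumes k: "2 \<le> k" and t: "0 \<le> t"
    and inj: "inj_on \<tau> {1..n}" and T: "\<And>i. i \<in> {1..n} \<Longrightarrow> 0 \<le> \<tau> i"
  shows "real (card {d \<in> {1..n} \<rightarrow>\<^sub>E {1..k}. max_sup_stat k (\<lambda>i \<tau>. \<tau> i) (\<lambda>i _. d i) n \<tau> \<le> t})
    = real k ^ n * orthonormal_steps.survival {1..k} {2..k} (contrast_step k) (1 / sqrt (real n)) n (\<lambda>_. t)"
proof -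
  interpret orthonormal_steps "{1..k}" "{2..k}" "contrast_step k"
    using k by (intro orthonormal_contrast_step) simp
  define js where "js = sort_key \<tau> [1..<Suc n]"
  have js: "set js = {1..n}" "distinct js" "length js = n"
    by (auto simp: js_def)
  let ?G = "stays_nonneg (1 / sqrt (real n)) (\<lambda>_. t)"
  have "max_sup_stat k (\<lambda>i \<tau>. \<tau> i) (\<lambda>i _. d i) n \<tau> \<le> t \<longleftrightarrow> ?G (map d js)"
    if "d \<in> {1..n} \<rightarrow>\<^sub>E {1..k}" for d
    using max_sup_stat_le_iff_stays_nonneg[where Ts = "\<lambda>i \<tau>. \<tau> i" and \<delta>s = "\<lambda>i _. d i" and \<omega> = \<tau>, OF k t] inj T that
    by (auto simp: js_def PiE_iff)
  then have 1: "{d \<in> {1..n} \<rightarrow>\<^sub>E {1..k}. max_sup_stat k (\<lambda>i \<tau>. \<tau> i) (\<lambda>i _. d i) n \<tau> \<le> t}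
      = {d \<in> {1..n} \<rightarrow>\<^sub>E {1..k}. ?G (map d js)}"
    by blast
  have 2: "card {d \<in> {1..n} \<rightarrow>\<^sub>E {1..k}. ?G (map d js)} = card {l. set l \<subseteq> {1..k} \<and> length l = n \<and> ?G l}"
  proof (rule bij_betw_same_card)
    have "bij_betw (\<lambda>d. map d js) ({1..n} \<rightarrow>\<^sub>E {1..k}) {l. set l \<subseteq> {1..k} \<and> length l = n}"
      using bij_betw_map_distinct[OF js(2), of "{1..k}"] js by simp
    then show "bij_betw (\<lambda>d. map d js) {d \<in> {1..n} \<rightarrow>\<^sub>E {1..k}. ?G (map d js)}
        {l. set l \<subseteq> {1..k} \<and> length l = n \<and> ?G l}"
      by (auto simp: bij_betw_def inj_on_def)
  qed
  show ?thesis
    unfolding 1 2 card_stays_nonneg by simp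
qed

section \<open>Competing risks\<close>

locale competing_risks = P: prob_space P + M: prob_space M
  for P :: "'b measure" and M :: "'a measure" +
  fixes T :: "'b \<Rightarrow> real" and \<delta> :: "'b \<Rightarrow> nat"
    and Ts :: "nat \<Rightarrow> 'a \<Rightarrow> real" and \<delta>s :: "nat \<Rightarrow> 'a \<Rightarrow> nat" and k :: nat
  assumes k: "2 \<le> k"
    and T_meas [measurable]: "T \<in> borel_measurable P"
    and \<delta>_meas [measurable]: "\<delta> \<in> measurable P (count_space UNIV)"
    and T_nonneg: "\<forall>\<omega>\<in>space P. T \<omega> \<ge> 0"
    and \<delta>_range: "\<forall>\<omega>\<in>space P. \<delta> \<omega> \<in> {1..k}"
    and F_cont: "continuous_on UNIV (cdf (distr P borel T))"
    and indep: "M.indep_vars (\<lambda>_. borel \<Otimes>\<^sub>M count_space UNIV) (\<lambda>i \<omega>. (Ts i \<omega>, \<delta>s i \<omega>)) {1..}"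
    and ident: "\<forall>i\<ge>1. distr M (borel \<Otimes>\<^sub>M count_space UNIV) (\<lambda>\<omega>. (Ts i \<omega>, \<delta>s i \<omega>))
                  = distr P (borel \<Otimes>\<^sub>M count_space UNIV) (\<lambda>\<omega>. (T \<omega>, \<delta> \<omega>))"
    and H0: "\<forall>i\<in>{1..k}. \<forall>j\<in>{1..k}. cum_inc P T \<delta> i = cum_inc P T \<delta> j"
begin

section \<open>Causes are uniform and independent of the times\<close>

lemma pair_measurable:
  "1 \<le> i \<Longrightarrow> (\<lambda>\<omega>. (Ts i \<omega>, \<delta>s i \<omega>)) \<in> measurable M (borel \<Otimes>\<^sub>M count_space UNIV)"
  using indep by (auto simp: M.indep_vars_def)

lemma Ts_measurable [measurable]: "1 \<le> i \<Longrightarrow> Ts i \<in> borel_measurable M"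
  using measurable_compose[OF pair_measurable measurable_fst] by simp

lemma \<delta>s_measurable [measurable]: "1 \<le> i \<Longrightarrow> \<delta>s i \<in> measurable M (count_space UNIV)"
  using measurable_compose[OF pair_measurable measurable_snd] by simp

lemma prob_transfer:
  assumes "1 \<le> i" and S: "S \<in> sets (borel \<Otimes>\<^sub>M count_space UNIV)"
  shows "M.prob {\<omega>\<in>space M. (Ts i \<omega>, \<delta>s i \<omega>) \<in> S} = P.prob {\<omega>\<in>space P. (T \<omega>, \<delta> \<omega>) \<in> S}"
proof -
  have "M.prob {\<omega>\<in>space M. (Ts i \<omega>, \<delta>s i \<omega>) \<in> S}
      = measure (distr M (borel \<Otimes>\<^sub>M count_space UNIV) (\<lambda>\<omega>. (Ts i \<omega>, \<delta>s i \<omega>))) S"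
    using S pair_measurable[OF assms(1)]
    by (subst measure_distr) (auto intro: arg_cong[where f = M.prob])
  also have "\<dots> = measure (distr P (borel \<Otimes>\<^sub>M count_space UNIV) (\<lambda>\<omega>. (T \<omega>, \<delta> \<omega>))) S"
    using ident assms(1) by simp
  also have "\<dots> = P.prob {\<omega>\<in>space P. (T \<omega>, \<delta> \<omega>) \<in> S}"
    using S by (subst measure_distr) (auto intro: arg_cong[where f = P.prob])
  finally show ?thesis .
qed

text \<open>The measures \<open>N j\<close>, the law of \<open>T\<close> restricted to cause
  \<open>j\<close>, have the cumulative incidence functions as distribution functions, so
  \<open>H0\<close> makes them coincide. They add up to the law of \<open>T\<close>, so each is its
  \<open>k\<close>-th part.\<close>

lemma prob_T_cause:
  assumes A: "A \<in> sets borel" and d: "d \<in> {1..k}"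
  shows "P.prob {\<omega>\<in>space P. T \<omega> \<in> A \<and> \<delta> \<omega> = d} = P.prob {\<omega>\<in>space P. T \<omega> \<in> A} / real k"
proof -
  define N where "N j = distr (density P (indicator {\<omega>\<in>space P. \<delta> \<omega> = j})) borel T" for j
  have measure_N: "measure (N j) A = P.prob {\<omega>\<in>space P. T \<omega> \<in> A \<and> \<delta> \<omega> = j}"
    if [measurable]: "A \<in> sets borel" for j A
  proof -
    have "measure (N j) A
        = measure (density P (indicator {\<omega>\<in>space P. \<delta> \<omega> = j})) (T -` A \<inter> space P)"
      unfolding N_def by (subst measure_distr) auto
    also have "\<dots> = P.prob ({\<omega>\<in>space P. \<delta> \<omega> = j} \<inter> (T -` A \<inter> space P))"
      by (subst measure_restricted) auto
    also have "{\<omega>\<in>space P. \<delta> \<omega> = j} \<inter> (T -` A \<inter> space P) = {\<omega>\<in>space P. T \<omega> \<in> A \<and> \<delta> \<omega> = j}" by auto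
    finally show ?thesis .
  qed
  have fin: "finite_borel_measure (N j)" for j
  proof (intro finite_borel_measure.intro finite_measureI finite_borel_measure_axioms.intro)
    have "emeasure (N j) (space (N j)) = emeasure P {\<omega>\<in>space P. \<delta> \<omega> = j}"
      unfolding N_def by (subst emeasure_distr) (auto simp: emeasure_restricted intro!: arg_cong[where f = "emeasure P"])
    then show "emeasure (N j) (space (N j)) \<noteq> \<infinity>" by simp
  qed (simp add: N_def)
  have "N j = N d" if "j \<in> {1..k}" for j
  proof (rule cdf_unique'[OF fin fin])
    have "cdf (N i) = cum_inc P T \<delta> i" for i
      by (auto simp: cdf_def cum_inc_def measure_N)
    then show "cdf (N j) = cdf (N d)" using H0 that d by metis
  qed
  then have eq: "P.prob {\<omega>\<in>space P. T \<omega> \<in> A \<and> \<delta> \<omega> = j} = P.prob {\<omega>\<in>space P. T \<omega> \<in> A \<and> \<delta> \<omega> = d}"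
    if "j \<in> {1..k}" for j
    using measure_N[OF A] that by metis
  note [measurable] = A
  have "P.prob {\<omega>\<in>space P. T \<omega> \<in> A} = P.prob (\<Union>j\<in>{1..k}. {\<omega>\<in>space P. T \<omega> \<in> A \<and> \<delta> \<omega> = j})"
    using \<delta>_range by (intro arg_cong[where f = P.prob]) auto
  also have "\<dots> = (\<Sum>j\<in>{1..k}. P.prob {\<omega>\<in>space P. T \<omega> \<in> A \<and> \<delta> \<omega> = j})"
    by (intro P.finite_measure_finite_Union) (auto simp: disjoint_family_on_def)
  also have "\<dots> = real k * P.prob {\<omega>\<in>space P. T \<omega> \<in> A \<and> \<delta> \<omega> = d}"
    by (simp add: eq)
  finally show ?thesis using k by simp
qed

lemma prob_Ts_cause:
  assumes "1 \<le> i" and [measurable]: "A \<in> sets borel" and d: "d \<in> {1..k}"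
  shows "M.prob {\<omega>\<in>space M. Ts i \<omega> \<in> A \<and> \<delta>s i \<omega> = d} = M.prob {\<omega>\<in>space M. Ts i \<omega> \<in> A} / real k"
proof -
  have "A \<times> {d} \<in> sets (borel \<Otimes>\<^sub>M count_space UNIV)" "A \<times> UNIV \<in> sets (borel \<Otimes>\<^sub>M (count_space UNIV :: nat measure))"
    by auto
  from this[THEN prob_transfer[OF assms(1)]] show ?thesis
    using prob_T_cause[OF assms(2,3)] by simp
qed

lemma prob_rectangle:
  assumes n: "1 \<le> n" and S: "\<And>i. i \<in> {1..n} \<Longrightarrow> S i \<in> sets (borel \<Otimes>\<^sub>M count_space UNIV)"
  shows "M.prob {\<omega>\<in>space M. \<forall>i\<in>{1..n}. (Ts i \<omega>, \<delta>s i \<omega>) \<in> S i}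
    = (\<Prod>i\<in>{1..n}. M.prob {\<omega>\<in>space M. (Ts i \<omega>, \<delta>s i \<omega>) \<in> S i})"
proof -
  have "{\<omega>\<in>space M. \<forall>i\<in>{1..n}. (Ts i \<omega>, \<delta>s i \<omega>) \<in> S i}
      = (\<Inter>i\<in>{1..n}. (\<lambda>\<omega>. (Ts i \<omega>, \<delta>s i \<omega>)) -` S i \<inter> space M)"
    using n by (auto simp: Ball_def)
  moreover have "{\<omega>\<in>space M. (Ts i \<omega>, \<delta>s i \<omega>) \<in> S i} = (\<lambda>\<omega>. (Ts i \<omega>, \<delta>s i \<omega>)) -` S i \<inter> space M" for i
    by auto
  ultimately show ?thesis
    using M.indep_varsD[OF indep, of "{1..n}" S] n S by auto
qed

abbreviation times :: "nat \<Rightarrow> 'a \<Rightarrow> nat \<Rightarrow> real" where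
  "times n \<omega> \<equiv> \<lambda>i\<in>{1..n}. Ts i \<omega>"

lemma times_measurable [measurable]: "times n \<in> measurable M (PiM {1..n} (\<lambda>_. borel))"
  by (rule measurable_restrict) auto

text \<open>For fixed \<open>d\<close> both sides are finite measures in \<open>B\<close>.
  Independence makes them agree on rectangles, and these determine such measures.\<close>

lemma prob_times_causes:
  assumes n: "1 \<le> n" and d: "d \<in> {1..n} \<rightarrow>\<^sub>E {1..k}" and B: "B \<in> sets (PiM {1..n} (\<lambda>_. borel))"
  shows "M.prob {\<omega>\<in>space M. times n \<omega> \<in> B \<and> (\<forall>i\<in>{1..n}. \<delta>s i \<omega> = d i)}
    = M.prob {\<omega>\<in>space M. times n \<omega> \<in> B} / real k ^ n"
proof -
  let ?\<Pi> = "PiM {1..n} (\<lambda>_. borel :: real measure)"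
  let ?E = "{\<omega>\<in>space M. \<forall>i\<in>{1..n}. \<delta>s i \<omega> = d i}"
  have E [measurable]: "?E \<in> sets M" by measurable
  define \<mu> where "\<mu> = distr (density M (indicator ?E)) ?\<Pi> (times n)"
  define \<nu> where "\<nu> = scale_measure (ennreal (1 / real k ^ n)) (distr M ?\<Pi> (times n))"
  have \<mu>: "emeasure \<mu> B = M.prob {\<omega>\<in>space M. times n \<omega> \<in> B \<and> (\<forall>i\<in>{1..n}. \<delta>s i \<omega> = d i)}"
    if [measurable]: "B \<in> sets ?\<Pi>" for B
  proof -
    have "emeasure \<mu> B = emeasure (density M (indicator ?E)) (times n -` B \<inter> space M)"
      unfolding \<mu>_def by (subst emeasure_distr[OF _ that]) auto
    also have "\<dots> = emeasure M (?E \<inter> (times n -` B \<inter> space M))"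
      by (rule emeasure_restricted[OF E measurable_sets[OF times_measurable that]])
    also have "?E \<inter> (times n -` B \<inter> space M)
        = {\<omega>\<in>space M. times n \<omega> \<in> B \<and> (\<forall>i\<in>{1..n}. \<delta>s i \<omega> = d i)}" by auto
    finally show ?thesis by (simp add: M.emeasure_eq_measure)
  qed
  have \<nu>: "emeasure \<nu> B = ennreal (M.prob {\<omega>\<in>space M. times n \<omega> \<in> B} / real k ^ n)"
    if [measurable]: "B \<in> sets ?\<Pi>" for B
  proof -
    have "emeasure (distr M ?\<Pi> (times n)) B = emeasure M {\<omega>\<in>space M. times n \<omega> \<in> B}"
      by (subst emeasure_distr[OF times_measurable that]) (auto intro!: arg_cong[where f = "emeasure M"])
    then show ?thesis
      by (simp add: \<nu>_def M.emeasure_eq_measure divide_inverse mult.commute flip: ennreal_mult)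
  qed
  have "\<mu> = \<nu>"
  proof (rule measure_eqI_PiM_finite[where I = "{1..n}" and M = "\<lambda>_. borel"])
    show "sets \<mu> = sets ?\<Pi>" "sets \<nu> = sets ?\<Pi>" by (simp_all add: \<mu>_def \<nu>_def)
    fix A :: "nat \<Rightarrow> real set" assume A: "\<And>i. i \<in> {1..n} \<Longrightarrow> A i \<in> sets borel"
    then have PA: "Pi\<^sub>E {1..n} A \<in> sets ?\<Pi>" by auto
    have "M.prob {\<omega>\<in>space M. times n \<omega> \<in> Pi\<^sub>E {1..n} A \<and> (\<forall>i\<in>{1..n}. \<delta>s i \<omega> = d i)}
        = M.prob {\<omega>\<in>space M. \<forall>i\<in>{1..n}. (Ts i \<omega>, \<delta>s i \<omega>) \<in> A i \<times> {d i}}"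
      by (intro arg_cong[where f = M.prob]) (auto simp: PiE_iff)
    also have "\<dots> = (\<Prod>i\<in>{1..n}. M.prob {\<omega>\<in>space M. (Ts i \<omega>, \<delta>s i \<omega>) \<in> A i \<times> {d i}})"
      using A by (intro prob_rectangle n) auto
    \<comment> \<open>Each cause contributes the factor \<open>1 / k\<close>, whichever value
      \<open>d i\<close> prescribes.\<close>
    also have "\<dots> = (\<Prod>i\<in>{1..n}. M.prob {\<omega>\<in>space M. (Ts i \<omega>, \<delta>s i \<omega>) \<in> A i \<times> UNIV} / real k)"
      using A d by (intro prod.cong refl) (simp add: prob_Ts_cause PiE_iff)
    also have "\<dots> = (\<Prod>i\<in>{1..n}. M.prob {\<omega>\<in>space M. (Ts i \<omega>, \<delta>s i \<omega>) \<in> A i \<times> UNIV}) / real k ^ n"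
      by (simp add: prod_dividef)
    also have "(\<Prod>i\<in>{1..n}. M.prob {\<omega>\<in>space M. (Ts i \<omega>, \<delta>s i \<omega>) \<in> A i \<times> UNIV})
        = M.prob {\<omega>\<in>space M. \<forall>i\<in>{1..n}. (Ts i \<omega>, \<delta>s i \<omega>) \<in> A i \<times> UNIV}"
      using A by (intro prob_rectangle[symmetric] n) auto
    also have "\<dots> = M.prob {\<omega>\<in>space M. times n \<omega> \<in> Pi\<^sub>E {1..n} A}"
      by (intro arg_cong[where f = M.prob]) (auto simp: PiE_iff)
    finally show "emeasure \<mu> (Pi\<^sub>E {1..n} A) = emeasure \<nu> (Pi\<^sub>E {1..n} A)"
      by (simp only: \<mu>[OF PA] \<nu>[OF PA])
  next
    show "range (\<lambda>_::nat. {1..n} \<rightarrow>\<^sub>E UNIV) \<subseteq> prod_algebra {1..n} (\<lambda>_. borel :: real measure)"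
      by (auto intro!: prod_algebraI_finite)
    show "(\<Union>i::nat. {1..n} \<rightarrow>\<^sub>E UNIV) = space ?\<Pi>" by (simp add: space_PiM)
    have "{1..n} \<rightarrow>\<^sub>E UNIV \<in> sets ?\<Pi>" by auto
    then show "emeasure \<mu> ({1..n} \<rightarrow>\<^sub>E UNIV) \<noteq> \<infinity>" by (simp add: \<mu>)
  qed simp
  then have "ennreal (M.prob {\<omega>\<in>space M. times n \<omega> \<in> B \<and> (\<forall>i\<in>{1..n}. \<delta>s i \<omega> = d i)})
      = ennreal (M.prob {\<omega>\<in>space M. times n \<omega> \<in> B} / real k ^ n)"
    using \<mu>[OF B] \<nu>[OF B] by simp
  then show ?thesis by simp
qed

section \<open>Almost sure properties of the sample\<close>

lemma AE_nonneg: "1 \<le> i \<Longrightarrow> AE \<omega> in M. 0 \<le> Ts i \<omega>"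
proof -
  assume i: "1 \<le> i"
  have "{0..} \<times> UNIV \<in> sets (borel \<Otimes>\<^sub>M count_space UNIV :: (real \<times> nat) measure)" by auto
  from prob_transfer[OF i this] have "M.prob {\<omega>\<in>space M. 0 \<le> Ts i \<omega>} = P.prob {\<omega>\<in>space P. 0 \<le> T \<omega>}"
    by simp
  also have "{\<omega>\<in>space P. 0 \<le> T \<omega>} = space P" using T_nonneg by auto
  finally show ?thesis
    using i by (intro M.prob_Collect_eq_1[THEN iffD1]) (auto simp: P.prob_space)
qed

lemma AE_cause: "1 \<le> i \<Longrightarrow> AE \<omega> in M. \<delta>s i \<omega> \<in> {1..k}"
proof -
  assume i: "1 \<le> i"
  have "UNIV \<times> {1..k} \<in> sets (borel \<Otimes>\<^sub>M count_space UNIV :: (real \<times> nat) measure)" by auto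
  from prob_transfer[OF i this] have "M.prob {\<omega>\<in>space M. \<delta>s i \<omega> \<in> {1..k}} = P.prob {\<omega>\<in>space P. \<delta> \<omega> \<in> {1..k}}"
    by simp
  also have "{\<omega>\<in>space P. \<delta> \<omega> \<in> {1..k}} = space P" using \<delta>_range by auto
  finally show ?thesis
    using i by (intro M.prob_Collect_eq_1[THEN iffD1]) (auto simp: P.prob_space)
qed

lemma prob_Ts_atom:
  assumes i: "1 \<le> i" shows "M.prob {\<omega>\<in>space M. Ts i \<omega> = x} = 0"
proof -
  interpret D: real_distribution "distr P borel T" by (rule P.real_distribution_distr) simp
  have "{x} \<times> UNIV \<in> sets (borel \<Otimes>\<^sub>M count_space UNIV :: (real \<times> nat) measure)" by auto
  from prob_transfer[OF i this] have "M.prob {\<omega>\<in>space M. Ts i \<omega> = x} = P.prob {\<omega>\<in>space P. T \<omega> = x}"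
    by simp
  also have "\<dots> = measure (distr P borel T) {x}"
    by (subst measure_distr) (auto intro!: arg_cong[where f = P.prob])
  also have "\<dots> = 0"
    using F_cont D.isCont_cdf[of x] by (simp add: continuous_on_eq_continuous_at)
  finally show ?thesis .
qed

text \<open>By independence the joint law is a product, and the sections of the diagonal are single
  points, which are null because \<open>F\<close> is continuous.\<close>

lemma AE_distinct:
  assumes i: "1 \<le> i" and j: "1 \<le> j" and "i \<noteq> j"
  shows "AE \<omega> in M. Ts i \<omega> \<noteq> Ts j \<omega>"
proof -
  have [measurable]: "Ts i \<in> borel_measurable M" "Ts j \<in> borel_measurable M" using i j by auto
  \<comment> \<open>The independent family is restricted to the disjoint index sets
    \<open>{i}\<close> and \<open>{j}\<close>, then projected to the times.\<close>
  have "M.indep_var borel ((\<lambda>f. fst (f i)) \<circ> (\<lambda>\<omega>. \<lambda>i\<in>{i}. (Ts i \<omega>, \<delta>s i \<omega>)))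
      borel ((\<lambda>f. fst (f j)) \<circ> (\<lambda>\<omega>. \<lambda>i\<in>{j}. (Ts i \<omega>, \<delta>s i \<omega>)))"
    using assms by (intro M.indep_var_compose[OF M.indep_var_restrict[OF indep]]) auto
  then have "M.indep_var borel (Ts i) borel (Ts j)" by (simp add: comp_def)
  then have prod: "distr M borel (Ts i) \<Otimes>\<^sub>M distr M borel (Ts j) = distr M (borel \<Otimes>\<^sub>M borel) (\<lambda>\<omega>. (Ts i \<omega>, Ts j \<omega>))"
    by (simp add: M.indep_var_distribution_eq)
  interpret Dj: prob_space "distr M borel (Ts j)" by (rule M.prob_space_distr) simp
  let ?\<Delta> = "{p\<in>space (borel \<Otimes>\<^sub>M borel). fst p = (snd p :: real)}"
  have \<Delta>: "?\<Delta> \<in> sets (borel \<Otimes>\<^sub>M borel)" by measurable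
  have "emeasure M {\<omega>\<in>space M. Ts i \<omega> = Ts j \<omega>}
      = emeasure (distr M (borel \<Otimes>\<^sub>M borel) (\<lambda>\<omega>. (Ts i \<omega>, Ts j \<omega>))) ?\<Delta>"
    using \<Delta> by (subst emeasure_distr) (auto intro!: arg_cong[where f = "emeasure M"] simp: space_pair_measure)
  also have "\<dots> = (\<integral>\<^sup>+x. emeasure (distr M borel (Ts j)) (Pair x -` ?\<Delta>) \<partial>distr M borel (Ts i))"
    unfolding prod[symmetric] using \<Delta>
    by (intro Dj.emeasure_pair_measure_alt) (simp cong: sets_pair_measure_cong)
  also have "\<dots> = (\<integral>\<^sup>+x. 0 \<partial>distr M borel (Ts i))"
  proof (rule nn_integral_cong)
    fix x
    have "Pair x -` ?\<Delta> = {x}" by (auto simp: space_pair_measure)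
    then have "emeasure (distr M borel (Ts j)) (Pair x -` ?\<Delta>) = emeasure M {\<omega>\<in>space M. Ts j \<omega> = x}"
      by (subst emeasure_distr) (auto intro!: arg_cong[where f = "emeasure M"])
    then show "emeasure (distr M borel (Ts j)) (Pair x -` ?\<Delta>) = 0"
      using prob_Ts_atom[OF j] by (simp add: M.emeasure_eq_measure)
  qed
  finally show ?thesis by (intro AE_I[where N = "{\<omega>\<in>space M. Ts i \<omega> = Ts j \<omega>}"]) auto
qed

section \<open>The exact law of the statistic for a finite sample\<close>

lemma max_sup_stat_measurable: "max_sup_stat k Ts \<delta>s n \<in> borel_measurable M"
  using k by (intro measurable_max_sup_stat) auto

text \<open>The event is split over all cause assignments \<open>d\<close>, each of weight
  \<open>1 / k ^ n\<close> independently of the times. For almost every vector of times the number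
  of favourable \<open>d\<close> is \<open>k ^ n\<close> times the survival probability, so
  averaging over the times leaves a constant.\<close>

theorem prob_max_sup_stat_le:
  assumes n: "1 \<le> n" and t: "0 \<le> t"
  shows "M.prob {\<omega>\<in>space M. max_sup_stat k Ts \<delta>s n \<omega> \<le> t}
    = orthonormal_steps.survival {1..k} {2..k} (contrast_step k) (1 / sqrt (real n)) n (\<lambda>_. t)"
proof -
  let ?\<Pi> = "PiM {1..n} (\<lambda>_. borel :: real measure)"
  let ?D = "{1..n} \<rightarrow>\<^sub>E {1..k}"
  let ?Q = "orthonormal_steps.survival {1..k} {2..k} (contrast_step k) (1 / sqrt (real n)) n (\<lambda>_. t)"
  \<comment> \<open>The time vectors that keep the statistic at most \<open>t\<close> when the
    causes are frozen to \<open>d\<close>.\<close>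
  define B where "B d = {\<tau>\<in>space ?\<Pi>. max_sup_stat k (\<lambda>i \<tau>. \<tau> i) (\<lambda>i _. d i) n \<tau> \<le> t}" for d
  have B: "B d \<in> sets ?\<Pi>" for d
  proof -
    have [measurable]: "max_sup_stat k (\<lambda>i \<tau>. \<tau> i) (\<lambda>i _. d i) n \<in> borel_measurable ?\<Pi>"
      using k by (intro measurable_max_sup_stat) auto
    show ?thesis unfolding B_def by measurable
  qed
  have fin: "finite ?D" by (intro finite_PiE) auto
  have E [measurable]: "{\<omega>\<in>space M. times n \<omega> \<in> B d} \<in> sets M" for d
    using B by measurable
  have E': "{\<omega>\<in>space M. times n \<omega> \<in> B d \<and> (\<forall>i\<in>{1..n}. \<delta>s i \<omega> = d i)} \<in> sets M" for d
    using B by measurable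
  \<comment> \<open>Almost surely the sample satisfies what the sorting argument requires, in
    particular it has no ties.\<close>
  have AE_all: "AE \<omega> in M. \<forall>i\<in>{1..n}. 0 \<le> Ts i \<omega> \<and> \<delta>s i \<omega> \<in> {1..k} \<and> (\<forall>j\<in>{1..n}. i \<noteq> j \<longrightarrow> Ts i \<omega> \<noteq> Ts j \<omega>)"
  proof (rule AE_finite_allI)
    fix i assume i: "i \<in> {1..n}"
    have "AE \<omega> in M. \<forall>j\<in>{1..n}. i \<noteq> j \<longrightarrow> Ts i \<omega> \<noteq> Ts j \<omega>"
      using i AE_distinct[of i] by (intro AE_finite_allI) auto
    then show "AE \<omega> in M. 0 \<le> Ts i \<omega> \<and> \<delta>s i \<omega> \<in> {1..k} \<and> (\<forall>j\<in>{1..n}. i \<noteq> j \<longrightarrow> Ts i \<omega> \<noteq> Ts j \<omega>)"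
      using AE_nonneg[of i] AE_cause[of i] i by auto
  qed simp
  have "M.prob {\<omega>\<in>space M. max_sup_stat k Ts \<delta>s n \<omega> \<le> t}
      = M.prob (\<Union>d\<in>?D. {\<omega>\<in>space M. times n \<omega> \<in> B d \<and> (\<forall>i\<in>{1..n}. \<delta>s i \<omega> = d i)})"
  proof (rule M.finite_measure_eq_AE)
    show "AE \<omega> in M. (\<omega> \<in> {\<omega>\<in>space M. max_sup_stat k Ts \<delta>s n \<omega> \<le> t}) \<longleftrightarrow>
        (\<omega> \<in> (\<Union>d\<in>?D. {\<omega>\<in>space M. times n \<omega> \<in> B d \<and> (\<forall>i\<in>{1..n}. \<delta>s i \<omega> = d i)}))"
      using AE_all
    proof eventually_elim
      case (elim \<omega>)
      have eq: "max_sup_stat k (\<lambda>i \<tau>. \<tau> i) (\<lambda>i _. d i) n (times n \<omega>) = max_sup_stat k Ts \<delta>s n \<omega>"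
        if "\<forall>i\<in>{1..n}. \<delta>s i \<omega> = d i" for d
        using that by (intro max_sup_stat_cong) auto
      have "(\<lambda>i\<in>{1..n}. \<delta>s i \<omega>) \<in> ?D" using elim by auto
      moreover have "times n \<omega> \<in> space ?\<Pi>" by (auto simp: space_PiM)
      ultimately have "times n \<omega> \<in> B (\<lambda>i\<in>{1..n}. \<delta>s i \<omega>) \<longleftrightarrow> max_sup_stat k Ts \<delta>s n \<omega> \<le> t"
        using eq[of "\<lambda>i\<in>{1..n}. \<delta>s i \<omega>"] by (simp add: B_def)
      moreover have "max_sup_stat k Ts \<delta>s n \<omega> \<le> t"
        if "times n \<omega> \<in> B d" "\<forall>i\<in>{1..n}. \<delta>s i \<omega> = d i" for d
        using that(1) eq[OF that(2)] by (simp add: B_def)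
      moreover have "\<forall>i\<in>{1..n}. \<delta>s i \<omega> = (\<lambda>i\<in>{1..n}. \<delta>s i \<omega>) i" by simp
      ultimately show ?case
        using \<open>(\<lambda>i\<in>{1..n}. \<delta>s i \<omega>) \<in> ?D\<close> by blast
    qed
    show "{\<omega>\<in>space M. max_sup_stat k Ts \<delta>s n \<omega> \<le> t} \<in> sets M"
      using max_sup_stat_measurable by measurable
    show "(\<Union>d\<in>?D. {\<omega>\<in>space M. times n \<omega> \<in> B d \<and> (\<forall>i\<in>{1..n}. \<delta>s i \<omega> = d i)}) \<in> sets M"
      using fin E' by auto
  qed
  also have "\<dots> = (\<Sum>d\<in>?D. M.prob {\<omega>\<in>space M. times n \<omega> \<in> B d \<and> (\<forall>i\<in>{1..n}. \<delta>s i \<omega> = d i)})"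
  proof (rule M.finite_measure_finite_Union[OF fin])
    show "disjoint_family_on (\<lambda>d. {\<omega>\<in>space M. times n \<omega> \<in> B d \<and> (\<forall>i\<in>{1..n}. \<delta>s i \<omega> = d i)}) ?D"
      unfolding disjoint_family_on_def
    proof (intro ballI impI, rule ccontr)
      fix d d' assume d: "d \<in> ?D" "d' \<in> ?D" "d \<noteq> d'"
      assume "{\<omega>\<in>space M. times n \<omega> \<in> B d \<and> (\<forall>i\<in>{1..n}. \<delta>s i \<omega> = d i)} \<inter>
        {\<omega>\<in>space M. times n \<omega> \<in> B d' \<and> (\<forall>i\<in>{1..n}. \<delta>s i \<omega> = d' i)} \<noteq> {}"
      then have "\<forall>i\<in>{1..n}. d i = d' i" by force
      with d show False using PiE_ext by blast
    qed
  qed (use E' in auto)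
  also have "\<dots> = (\<Sum>d\<in>?D. M.prob {\<omega>\<in>space M. times n \<omega> \<in> B d}) / real k ^ n"
    unfolding sum_divide_distrib by (intro sum.cong refl prob_times_causes n B)
  \<comment> \<open>Probabilities become expectations of indicators, so that the sum over
    \<open>d\<close> can be taken first, pointwise in the times.\<close>
  also have "(\<Sum>d\<in>?D. M.prob {\<omega>\<in>space M. times n \<omega> \<in> B d})
      = (\<Sum>d\<in>?D. \<integral>\<omega>. indicator {\<omega>\<in>space M. times n \<omega> \<in> B d} \<omega> \<partial>M)"
    by (simp add: Int_absorb2 subset_eq)
  also have "\<dots> = (\<integral>\<omega>. (\<Sum>d\<in>?D. indicator {\<omega>\<in>space M. times n \<omega> \<in> B d} \<omega>) \<partial>M)"
    by (intro Bochner_Integration.integral_sum[symmetric] integrable_real_indicator E)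
      (simp add: M.emeasure_eq_measure)
  also have "\<dots> = (\<integral>\<omega>. real k ^ n * ?Q \<partial>M)"
  proof (rule integral_cong_AE)
    show "AE \<omega> in M. (\<Sum>d\<in>?D. indicator {\<omega>\<in>space M. times n \<omega> \<in> B d} \<omega>) = real k ^ n * ?Q"
      using AE_all AE_space
    proof eventually_elim
      case (elim \<omega>)
      have "(\<Sum>d\<in>?D. indicator {\<omega>\<in>space M. times n \<omega> \<in> B d} \<omega>)
          = (\<Sum>d\<in>{d\<in>?D. max_sup_stat k (\<lambda>i \<tau>. \<tau> i) (\<lambda>i _. d i) n (times n \<omega>) \<le> t}. 1 :: real)"
        using fin elim by (intro sum.mono_neutral_cong_right)
          (auto simp: B_def space_PiM indicator_def)
      also have "\<dots> = real k ^ n * ?Q"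
      proof -
        have "inj_on (times n \<omega>) {1..n}" by (rule inj_onI, rule ccontr) (use elim in auto)
        moreover have "0 \<le> times n \<omega> i" if "i \<in> {1..n}" for i using elim that by auto
        ultimately show ?thesis using card_max_sup_stat_le[OF k t, of "times n \<omega>" n] by simp
      qed
      finally show ?case .
    qed
  qed (intro borel_measurable_sum borel_measurable_indicator E borel_measurable_const)+
  finally show ?thesis using k M.prob_space by simp
qed

end

section \<open>The limit law\<close>

text \<open>The cut at 0 removes the odd continuation: the limit has no mass on the negative
  half-line.\<close>

definition limit_cdf :: "nat \<Rightarrow> real \<Rightarrow> real" where
  "limit_cdf m t = abs_normal_cdf (max 0 t) ^ m"

lemma
  assumes m: "0 < m"
  shows real_distribution_limit_cdf: "real_distribution (interval_measure (limit_cdf m))"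
    and cdf_interval_measure_limit_cdf: "cdf (interval_measure (limit_cdf m)) = limit_cdf m"
    and isCont_limit_cdf: "isCont (limit_cdf m) t"
proof -
  have mono: "limit_cdf m x \<le> limit_cdf m y" if "x \<le> y" for x y
    using that unfolding limit_cdf_def
    by (intro power_mono abs_normal_cdf_mono abs_normal_cdf_nonneg) auto
  have cont: "isCont (limit_cdf m) a" for a
    unfolding limit_cdf_def[abs_def] by (intro continuous_intros isCont_o2[OF _ isCont_abs_normal_cdf])
  then show "isCont (limit_cdf m) t" .
  have right: "continuous (at_right a) (limit_cdf m)" for a
    using cont continuous_at_imp_continuous_within by blast
  \<comment> \<open>Here \<open>0 < m\<close> matters, since a zeroth power would be 1
    everywhere.\<close>
  have bot: "(limit_cdf m \<longlongrightarrow> 0) at_bot"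
    using m by (intro tendsto_eventually eventually_at_bot_linorderI[of 0]) (simp add: limit_cdf_def)
  have "((\<lambda>t. abs_normal_cdf t ^ m) \<longlongrightarrow> 1 ^ m) at_top"
    by (intro tendsto_intros abs_normal_cdf_at_top)
  moreover have "\<forall>\<^sub>F t in at_top. abs_normal_cdf t ^ m = limit_cdf m t"
    using eventually_ge_at_top[of 0] by eventually_elim (simp add: limit_cdf_def)
  ultimately have top: "(limit_cdf m \<longlongrightarrow> 1) at_top"
    by (simp add: tendsto_cong)
  show "real_distribution (interval_measure (limit_cdf m))"
    using mono right bot top by (rule real_distribution_interval_measure)
  show "cdf (interval_measure (limit_cdf m)) = limit_cdf m"
    using mono right bot by (rule cdf_interval_measure)
qed

text \<open>For nonnegative \<open>t\<close> the exact law reduces convergence to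
  \<open>survival_tendsto\<close>. For smaller \<open>t\<close> the probabilities lie between 0 and
  those at 0, which tend to 0 because \<open>k - 1\<close> is positive.\<close>

lemma (in competing_risks) weak_conv_max_sup_stat:
  "weak_conv_m (\<lambda>n. distr M borel (max_sup_stat k Ts \<delta>s n)) (interval_measure (limit_cdf (k - 1)))"
proof -
  interpret W: orthonormal_steps "{1..k}" "{2..k}" "contrast_step k"
    using k by (intro orthonormal_contrast_step) simp
  note [measurable] = max_sup_stat_measurable
  let ?F = "\<lambda>n t. M.prob {\<omega>\<in>space M. max_sup_stat k Ts \<delta>s n \<omega> \<le> t}"
  have card: "card {2..k} = k - 1" by simp
  have nonneg: "(\<lambda>n. ?F n t) \<longlonglongrightarrow> limit_cdf (k - 1) t" if t: "0 \<le> t" for t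
  proof (rule Lim_transform_eventually)
    show "(\<lambda>n. W.survival (1 / sqrt (real n)) n (\<lambda>_. t)) \<longlonglongrightarrow> limit_cdf (k - 1) t"
      using W.survival_tendsto[OF t] t by (simp add: limit_cdf_def)
    show "\<forall>\<^sub>F n in sequentially. W.survival (1 / sqrt (real n)) n (\<lambda>_. t) = ?F n t"
      using eventually_ge_at_top[of 1] by eventually_elim (simp add: prob_max_sup_stat_le t)
  qed
  have neg: "(\<lambda>n. ?F n t) \<longlonglongrightarrow> limit_cdf (k - 1) t" if t: "t \<le> 0" for t
  proof -
    have L: "limit_cdf (k - 1) 0 = 0" "limit_cdf (k - 1) t = 0"
      using k t by (simp_all add: limit_cdf_def)
    have le: "?F n t \<le> ?F n 0" for n
      using t by (intro M.finite_measure_mono) auto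
    have "(\<lambda>n. ?F n t) \<longlonglongrightarrow> 0"
    proof (rule tendsto_sandwich)
      show "(\<lambda>_. 0 :: real) \<longlonglongrightarrow> 0" by (rule tendsto_const)
      show "(\<lambda>n. ?F n 0) \<longlonglongrightarrow> 0" using nonneg[of 0] unfolding L by simp
    qed (intro always_eventually allI measure_nonneg le)+
    then show ?thesis unfolding L .
  qed
  have "(\<lambda>n. ?F n t) \<longlonglongrightarrow> limit_cdf (k - 1) t" for t
    using nonneg neg by (cases "0 \<le> t") simp_all
  moreover have "cdf (distr M borel (max_sup_stat k Ts \<delta>s n)) t = ?F n t" for n t
    unfolding cdf_def by (subst measure_distr) (auto intro!: arg_cong[where f = M.prob])
  moreover have "cdf (interval_measure (limit_cdf (k - 1))) = limit_cdf (k - 1)"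
    using k by (intro cdf_interval_measure_limit_cdf) simp
  ultimately show ?thesis
    by (simp only: weak_conv_m_def weak_conv_def) blast
qed

theorem mainTheorem5:
  fixes P :: "'b measure" and T :: "'b \<Rightarrow> real" and \<delta> :: "'b \<Rightarrow> nat"
    and M :: "'a measure" and Ts :: "nat \<Rightarrow> 'a \<Rightarrow> real" and \<delta>s :: "nat \<Rightarrow> 'a \<Rightarrow> nat"
    and k :: nat
  assumes k: "k \<ge> 3"
    and P: "prob_space P"
    and T_meas: "T \<in> borel_measurable P"
    and \<delta>_meas: "\<delta> \<in> measurable P (count_space UNIV)"
    and T_nonneg: "\<forall>\<omega>\<in>space P. T \<omega> \<ge> 0"
    and \<delta>_range: "\<forall>\<omega>\<in>space P. \<delta> \<omega> \<in> {1..k}"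
    and F_cont: "continuous_on UNIV (cdf (distr P borel T))"
    and M: "prob_space M"
    and indep: "prob_space.indep_vars M (\<lambda>_. borel \<Otimes>\<^sub>M count_space UNIV)
                  (\<lambda>i \<omega>. (Ts i \<omega>, \<delta>s i \<omega>)) {1..}"
    and ident: "\<forall>i\<ge>1. distr M (borel \<Otimes>\<^sub>M count_space UNIV) (\<lambda>\<omega>. (Ts i \<omega>, \<delta>s i \<omega>))
                  = distr P (borel \<Otimes>\<^sub>M count_space UNIV) (\<lambda>\<omega>. (T \<omega>, \<delta> \<omega>))"
    and H0: "\<forall>i\<in>{1..k}. \<forall>j\<in>{1..k}. cum_inc P T \<delta> i = cum_inc P T \<delta> j"
  shows "\<exists>(N :: real measure) (\<T> :: real \<Rightarrow> real).
           prob_space N \<and> \<T> \<in> borel_measurable N \<and>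
           (\<forall>t\<ge>0. measure N {\<omega> \<in> space N. \<T> \<omega> \<ge> t} = 1 - (2 * std_normal_cdf t - 1) ^ (k - 1)) \<and>
           weak_conv_m (\<lambda>n. distr M borel (max_sup_stat k Ts \<delta>s n)) (distr N borel \<T>)"
proof -
  interpret competing_risks P M T \<delta> Ts \<delta>s k
    by (intro competing_risks.intro competing_risks_axioms.intro assms) (use k in simp)
  \<comment> \<open>The limit variable is realised as the identity on the real line under the limit
    law.\<close>
  let ?N = "interval_measure (limit_cdf (k - 1))"
  have m: "0 < k - 1" using k by simp
  interpret N: real_distribution ?N by (rule real_distribution_limit_cdf[OF m])
  have "measure ?N {\<omega> \<in> space ?N. t \<le> \<omega>} = 1 - (2 * std_normal_cdf t - 1) ^ (k - 1)" if "0 \<le> t" for t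
  proof -
    \<comment> \<open>Without atoms the mass below \<open>t\<close> is the distribution function at
      \<open>t\<close> and not merely its left limit, so its complement is the claimed tail.\<close>
    have "measure ?N {t} = 0"
      using N.isCont_cdf[of t] isCont_limit_cdf[OF m, of t]
      unfolding cdf_interval_measure_limit_cdf[OF m] by blast
    moreover have "{..t} = {..<t} \<union> {t}" by auto
    then have "measure ?N {..t} = measure ?N {..<t} + measure ?N {t}"
      by (simp only:) (rule N.finite_measure_Union; auto)
    ultimately have "measure ?N {..<t} = limit_cdf (k - 1) t"
      using cdf_interval_measure_limit_cdf[OF m] by (metis add.right_neutral cdf_def)
    moreover have "{\<omega> \<in> space ?N. t \<le> \<omega>} = space ?N - {..<t}" by auto
    ultimately show ?thesis
      using that N.prob_compl[of "{..<t}"] by (simp add: limit_cdf_def abs_normal_cdf_def)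
  qed
  moreover have "distr ?N borel (\<lambda>x. x) = ?N"
    by (intro distr_id2) simp
  moreover have "prob_space ?N" by (rule N.prob_space_axioms)
  ultimately show ?thesis
    using weak_conv_max_sup_stat by (intro exI[of _ ?N] exI[of _ "\<lambda>x. x"]) simp
qed

end
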